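(* Let $W=\{w_1,\dots,w_m\}$ be a contact configuration of $m$ directions with bounded cell, with $\gamma_{ij}$ the angle between $w_i$ and $w_j$, let $U(r)$ be the measure of the set of points of $S^3$ at angular distance greater than $r$ from every direction of $W$, and let $\rho\ge1$. Then $$\mathrm{vol}\bigl(V_c(W)\cap B(\rho)\bigr)=\frac14\Bigl[2\pi^2+\int_0^{\arccos(1/\rho)}U(r)\,d(\sec^4r)\Bigr]\ \le\ \mathrm{vol}\bigl(V_c(W)\bigr),$$ and for $r<r_4$ $$U(r)=2\pi^2-mC(r)+\sum_{i<j}\Lambda(r,\gamma_{ij})-\sum_{i<j<k}\Lambda_3(r;\gamma_{ij},\gamma_{ik},\gamma_{jk}),$$ the last sum being absent for $r<r_*$. Consequently, with $$A_4=\frac14\Bigl[2\pi^2+\int_0^{r_4}\bigl(2\pi^2-23\,C(r)\bigr)\,d(\sec^4r)\Bigr]=7.647558\ldots,\qquad \omega_4(\gamma)=\frac14\int_0^{r_4}\Lambda(r,\gamma)\,d(\sec^4r),$$ and $\omega_3(\gamma,\gamma',\gamma'')=\frac14\int_0^{r_4}\Lambda_3(r;\gamma,\gamma',\gamma'')\,d(\sec^4r)$, every contact configuration of $23$ directions with bounded cell satisfies $$\mathrm{vol}(V_c)\ \ge\ \mathrm{vol}\bigl(V_c\cap B(\sqrt{8/5})\bigr)=A_4+\sum_{i<j}\omega_4(\gamma_{ij})-\sum_{i<j<k}\omega_3(\gamma_{ij},\gamma_{ik},\gamma_{jk}).$$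
   Context: A contact configuration is a finite set $W\subset S^3\subset\mathbb{R}^4$ of unit vectors with $\langle w,w'\rangle\le\frac12$ for all distinct $w,w'\in W$; its cell is $V_c=V_c(W)=\{x\in\mathbb{R}^4:\langle x,w\rangle\le1\ \forall w\in W\}$. $B(\rho)$ is the ball of radius $\rho$ about the origin. Measure on $S^3$ is the surface measure, of total mass $2\pi^2$. A cap of radius $r$ about $w\in S^3$ is the set of $\theta\in S^3$ at angular distance at most $r$ from $w$; its measure is $C(r)=\pi(2r-\sin2r)$. $\Lambda(r,\gamma)$ is the measure of the intersection of two caps of radius $r$ whose centres are at angle $\gamma$, and $\Lambda_3(r;\gamma,\gamma',\gamma'')$ the measure of the intersection of three caps of radius $r$ about directions at the given pairwise angles. $r_*=\arcsin(1/\sqrt3)$ and $r_4=\arcsin\sqrt{3/8}$. *)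

theory Defs
  imports "HOL-Analysis.Analysis"
begin

definition contact_configuration :: "(real ^ 4) set \<Rightarrow> bool" where
  "contact_configuration W \<longleftrightarrow>
     finite W \<and> W \<subseteq> sphere 0 1 \<and> (\<forall>w\<in>W. \<forall>w'\<in>W. w \<noteq> w' \<longrightarrow> w \<bullet> w' \<le> 1 / 2)"

definition cell :: "(real ^ 4) set \<Rightarrow> (real ^ 4) set" where
  "cell W = {x. \<forall>w\<in>W. x \<bullet> w \<le> 1}"

abbreviation vol :: "(real ^ 4) set \<Rightarrow> real" where
  "vol \<equiv> measure lebesgue"

text \<open>
  Surface measure on the unit sphere, as the cone measure: a Borel subset \<open>A\<close> of the sphere
  gets \<open>DIM('a)\<close> times the volume of \<open>{x. 0 < norm x < 1 \<and> x / norm x \<in> A}\<close>.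
\<close>
definition surface_measure :: "'a::euclidean_space measure" where
  "surface_measure =
     scale_measure (of_nat DIM('a))
       (distr (restrict_space lborel (ball 0 1 - {0})) (restrict_space borel (sphere 0 1)) sgn)"

abbreviation sigma3 :: "(real ^ 4) set \<Rightarrow> real" where
  "sigma3 \<equiv> measure surface_measure"

lemma space_surface_measure: "space (surface_measure :: 'a::euclidean_space measure) = sphere 0 1"
  by (simp add: surface_measure_def space_scale_measure space_restrict_space)

lemma surface_measure_total: "measure surface_measure (sphere 0 1 :: (real^4) set) = 2 * pi\<^sup>2"
proof -
  have m: "sgn \<in> measurable (restrict_space lborel (ball 0 1 - {0::real^4})) (restrict_space borel (sphere 0 1))"
    apply (rule measurable_restrict_space2)
     apply (auto simp: space_restrict_space norm_sgn)
    apply (rule measurable_restrict_space1)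
    unfolding sgn_div_norm by measurable
  have s: "sphere 0 1 \<in> sets (restrict_space borel (sphere (0::real^4) 1))"
    by (simp add: sets_restrict_space_iff)
  have pre: "sgn -` sphere 0 1 \<inter> space (restrict_space lborel (ball 0 1 - {0::real^4})) = ball 0 1 - {0}"
    by (auto simp: space_restrict_space norm_sgn)
  have "measure surface_measure (sphere 0 1 :: (real^4) set) = 4 * measure lborel (ball 0 1 - {0::real^4})"
    using emeasure_distr[OF m s] unfolding pre surface_measure_def measure_def
    by (simp add: emeasure_scale_measure emeasure_restrict_space enn2real_mult)
  also have "measure lborel (ball 0 1 - {0::real^4}) = measure lborel (ball (0::real^4) 1)"
    unfolding measure_def by (subst emeasure_Diff_null_set) auto
  also have "\<dots> = pi\<^sup>2 / 2"
    using content_ball[of 1 "0::real^4"] by (simp add: unit_ball_vol_def Gamma_fact[of 2, simplified] 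
      powr_numeral eval_nat_numeral)
  finally show ?thesis by simp
qed

text \<open>Angular distance; only used for unit vectors.\<close>
definition ang :: "'a::real_inner \<Rightarrow> 'a \<Rightarrow> real" where
  "ang u v = arccos (u \<bullet> v)"

definition cap :: "real \<Rightarrow> real ^ 4 \<Rightarrow> (real ^ 4) set" where
  "cap r w = {\<theta> \<in> sphere 0 1. ang \<theta> w \<le> r}"

text \<open>The \<open>surface_measure\<close> of a cap of radius \<open>r\<close>, for \<open>0 \<le> r \<le> pi\<close>.\<close>
definition C :: "real \<Rightarrow> real" where
  "C r = pi * (2 * r - sin (2 * r))"

definition U :: "(real ^ 4) set \<Rightarrow> real \<Rightarrow> real" where
  "U W r = sigma3 {\<theta> \<in> sphere 0 1. \<forall>w\<in>W. ang \<theta> w > r}"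

text \<open>
  By rotation invariance the two measures below depend only on the angles between the centres,
  so the descriptions are uniquely satisfied whenever the angles are realised by unit vectors;
  for other angles the values are unspecified.
\<close>
definition Lam :: "real \<Rightarrow> real \<Rightarrow> real" where
  "Lam r \<gamma> = (THE a. \<exists>u\<in>sphere 0 1. \<exists>v\<in>sphere 0 1.
     ang u v = \<gamma> \<and> a = sigma3 (cap r u \<inter> cap r v))"

definition Lam3 :: "real \<Rightarrow> real \<Rightarrow> real \<Rightarrow> real \<Rightarrow> real" where
  "Lam3 r \<gamma> \<gamma>' \<gamma>'' = (THE a. \<exists>u\<in>sphere 0 1. \<exists>v\<in>sphere 0 1. \<exists>w\<in>sphere 0 1.
     ang u v = \<gamma> \<and> ang u w = \<gamma>' \<and> ang v w = \<gamma>'' \<and>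
     a = sigma3 (cap r u \<inter> cap r v \<inter> cap r w))"

text \<open>
  The Lebesgue--Stieltjes integral of \<open>f\<close> against \<open>dg\<close> over \<open>[a, b]\<close>, for \<open>g\<close> continuous and
  nondecreasing on \<open>[a, b]\<close>. Clamping the argument of \<open>g\<close> to \<open>[a, b]\<close> is needed because
  \<open>interval_measure\<close> expects a function that is nondecreasing on all of the reals.
\<close>
definition stieltjes_integral :: "real \<Rightarrow> real \<Rightarrow> (real \<Rightarrow> real) \<Rightarrow> (real \<Rightarrow> real) \<Rightarrow> real" where
  "stieltjes_integral a b f g =
     (LINT x:{a<..b}|interval_measure (\<lambda>x. g (max a (min b x))). f x)"

definition sec4 :: "real \<Rightarrow> real" where
  "sec4 r = 1 / cos r ^ 4"

definition r_star :: real where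
  "r_star = arcsin (1 / sqrt 3)"

definition r4 :: real where
  "r4 = arcsin (sqrt (3 / 8))"

definition A4 :: real where
  "A4 = 1 / 4 * (2 * pi\<^sup>2 + stieltjes_integral 0 r4 (\<lambda>r. 2 * pi\<^sup>2 - 23 * C r) sec4)"

definition omega4 :: "real \<Rightarrow> real" where
  "omega4 \<gamma> = 1 / 4 * stieltjes_integral 0 r4 (\<lambda>r. Lam r \<gamma>) sec4"

definition omega3 :: "real \<Rightarrow> real \<Rightarrow> real \<Rightarrow> real" where
  "omega3 \<gamma> \<gamma>' \<gamma>'' = 1 / 4 * stieltjes_integral 0 r4 (\<lambda>r. Lam3 r \<gamma> \<gamma>' \<gamma>'') sec4"

end

theory Submission
  imports Defs
begin

text \<open>
  The polar form of Lebesgue measure is only needed as: a star-shaped set with radial function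
  \<open>f\<close> has volume \<open>\<integral> f(x / |x|)^n\<close> over the unit ball.
  For the truncated cell, \<open>f^4 - 1\<close> at a direction \<open>\<theta>\<close> is the \<open>d(sec^4)\<close>-measure of the radii
  \<open>r\<close> for which \<open>\<theta>\<close> is farther than \<open>r\<close> from every \<open>w \<in> W\<close>, so Fubini gives the volume formula.

  The formula for \<open>U\<close> is inclusion-exclusion, truncated because \<open>k\<close> unit vectors with pairwise
  inner products at most \<open>1/2\<close> have a sum of norm at most \<open>sqrt (k (k + 1) / 2)\<close>: four caps of
  radius below \<open>r4\<close>, or three of radius below \<open>r_star\<close>, have no common point.
  Integrating by parts gives \<open>A4\<close> in closed form.
\<close>

section \<open>Surface measure and volumes of star-shaped sets\<close>

text \<open>Since \<open>surface_measure\<close> is a cone measure, every integral over the sphere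
  is replaced by an integral over the unit ball of a function of \<open>sgn x\<close>. A cap becomes
  a solid sector, and Fubini is applied to the Stieltjes measure times Lebesgue measure on the ball.

  Two facts about caps need work in this setting. \<open>Lam\<close> and \<open>Lam3\<close> are
  definite descriptions, so they carry information only once any two realisations of the same angles
  are shown congruent; products of reflections supply the isometry. The value \<open>C r\<close> of
  a cap comes from slicing its sector into three-dimensional balls.

  The constants fit together. If k caps of radius r meet, then k cos r is at most sqrt (k (k + 1) /
  2). Equality for k = 4 and k = 3 gives cos r4 = sqrt (5/8) and cos r_star = sqrt (2/3). The
  truncation radius sqrt (8/5) is 1 / cos r4, so the radial integral stops exactly where quadruple
  intersections can first appear.\<close>

lemma sets_surface_measure:
  "sets (surface_measure :: 'a::euclidean_space measure) = sets (restrict_space borel (sphere 0 1))"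
  by (simp add: surface_measure_def)

lemma sets_surface_measureI:
  assumes "A \<in> sets borel" "A \<subseteq> sphere 0 (1::real)"
  shows "(A :: 'a::euclidean_space set) \<in> sets surface_measure"
  using assms by (auto simp: sets_surface_measure sets_restrict_space_iff)

lemma emeasure_surface_measure:
  fixes A :: "'a::euclidean_space set"
  assumes "A \<in> sets borel" "A \<subseteq> sphere 0 1"
  shows "emeasure surface_measure A
    = of_nat DIM('a) * emeasure lborel {x \<in> ball 0 1 - {0}. sgn x \<in> A}"
proof -
  have m: "sgn \<in> measurable (restrict_space lborel (ball 0 1 - {0::'a})) (restrict_space borel (sphere 0 1))"
    by (rule measurable_restrict_space2, force simp: space_restrict_space norm_sgn,
        rule measurable_restrict_space1) simp
  have s: "A \<in> sets (restrict_space borel (sphere 0 1))"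
    using assms by (simp add: sets_restrict_space_iff)
  have "sgn -` A \<inter> space (restrict_space lborel (ball 0 1 - {0})) = {x \<in> ball 0 1 - {0}. sgn x \<in> A}"
    by (auto simp: space_restrict_space)
  then show ?thesis
    using emeasure_distr[OF m s]
    by (simp add: surface_measure_def emeasure_scale_measure emeasure_restrict_space subset_eq)
qed

lemma cone_section_sets:
  fixes A :: "'a::euclidean_space set"
  assumes "A \<in> sets borel"
  shows "{x \<in> ball 0 1 - {0}. sgn x \<in> A} \<in> sets borel"
proof -
  have "{x \<in> ball 0 1 - {0}. sgn x \<in> A} = sgn -` A \<inter> (ball 0 1 - {0})" by auto
  then show ?thesis
    using measurable_sets[OF borel_measurable_sgn assms] by simp
qed

lemma finite_surface_measure: "finite_measure (surface_measure :: 'a::euclidean_space measure)"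
proof
  have "emeasure surface_measure (sphere 0 1 :: 'a set)
      \<le> of_nat DIM('a) * emeasure lborel (ball (0::'a) 1)"
    by (subst emeasure_surface_measure) (auto intro!: mult_left_mono emeasure_mono)
  also have "\<dots> < \<infinity>"
    by (auto simp: ennreal_mult_eq_top_iff less_top[symmetric] emeasure_ball)
  finally show "emeasure surface_measure (space (surface_measure :: 'a measure)) \<noteq> \<infinity>"
    by (simp add: space_surface_measure)
qed

lemma measure_surface_measure:
  fixes A :: "'a::euclidean_space set"
  assumes "A \<in> sets borel" "A \<subseteq> sphere 0 1"
  shows "measure surface_measure A = DIM('a) * measure lborel {x \<in> ball 0 1 - {0}. sgn x \<in> A}"
  using emeasure_surface_measure[OF assms] by (simp add: measure_def enn2real_mult)

section \<open>Volumes of cones and star-shaped sets\<close>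

lemma emeasure_cone_scale:
  fixes A :: "'a::euclidean_space set"
  assumes A: "A \<in> sets borel" and c: "0 \<le> c"
  shows "emeasure lborel {x. x \<noteq> 0 \<and> norm x < c \<and> sgn x \<in> A}
    = ennreal c ^ DIM('a) * emeasure lborel {x \<in> ball 0 1 - {0}. sgn x \<in> A}"
proof (cases "c = 0")
  case False
  with c have c: "c > 0" by simp
  let ?S = "{x \<in> ball 0 1 - {0}. sgn x \<in> A}"
  have img: "{x. x \<noteq> 0 \<and> norm x < c \<and> sgn x \<in> A} = (\<lambda>x. c *\<^sub>R x + 0) ` ?S"
  proof (intro set_eqI iffI)
    fix x assume x: "x \<in> {x. x \<noteq> 0 \<and> norm x < c \<and> sgn x \<in> A}"
    then have "inverse c *\<^sub>R x \<in> ?S" "x = c *\<^sub>R (inverse c *\<^sub>R x) + 0"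
      using c by (auto simp: sgn_scaleR divide_simps)
    then show "x \<in> (\<lambda>x. c *\<^sub>R x + 0) ` ?S" by blast
  qed (use c in \<open>auto simp: sgn_scaleR\<close>)
  have "emeasure lborel {x. x \<noteq> 0 \<and> norm x < c \<and> sgn x \<in> A}
      = emeasure lebesgue {x. x \<noteq> 0 \<and> norm x < c \<and> sgn x \<in> A}"
    using A by (simp add: emeasure_completion)
  also have "\<dots> = \<bar>c\<bar> ^ DIM('a) * emeasure lebesgue ?S"
    unfolding img by (rule emeasure_lebesgue_affine)
  finally show ?thesis
    using c cone_section_sets[OF A] by (simp add: ennreal_power)
qed (simp add: not_less[symmetric] zero_power)

text \<open>The values of a simple radial function split the body into finitely many disjoint
  truncated cones, and each cone is a scaled copy of its part in the unit ball. Values below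
  \<open>top\<close> ensure that every height is a real scaling factor.\<close>

lemma emeasure_star_simple:
  fixes g :: "'a::euclidean_space \<Rightarrow> ennreal"
  assumes g: "simple_function borel g" and fin: "\<And>x. g x < top"
  shows "emeasure lborel {x. x \<noteq> 0 \<and> ennreal (norm x) < g (sgn x)}
    = (\<integral>\<^sup>+x. g (sgn x) ^ DIM('a) * indicator (ball 0 1 - {0}) x \<partial>lborel)"
proof -
  have [measurable]: "g \<in> borel_measurable borel"
    using g by (rule borel_measurable_simple_function)
  have fr: "finite (range g)"
    using g by (auto simp: simple_function_def)
  let ?S = "\<lambda>c. {x. x \<noteq> 0 \<and> ennreal (norm x) < c \<and> sgn x \<in> g -` {c}}"
  let ?T = "\<lambda>c. {x \<in> ball 0 1 - {0}. sgn x \<in> g -` {c}}"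
  have gm: "g -` {c} \<in> sets borel" for c
    using measurable_sets_borel[of g borel "{c}"] by simp
  have eqS: "{x. x \<noteq> 0 \<and> ennreal (norm x) < g (sgn x)} = (\<Union>c\<in>range g. ?S c)"
    by auto
  have "emeasure lborel {x. x \<noteq> 0 \<and> ennreal (norm x) < g (sgn x)} = (\<Sum>c\<in>range g. emeasure lborel (?S c))"
    unfolding eqS
    by (rule sum_emeasure[symmetric]) (auto simp: disjoint_family_on_def fr intro!: measurable_sets_borel)
  also have "\<dots> = (\<Sum>c\<in>range g. c ^ DIM('a) * emeasure lborel (?T c))"
  proof (rule sum.cong)
    fix c assume "c \<in> range g"
    then have "c < top" using fin by auto
    then obtain r where r: "c = ennreal r" "0 \<le> r" by (cases c) auto
    have "?S c = {x. x \<noteq> 0 \<and> norm x < r \<and> sgn x \<in> g -` {c}}"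
      using r by (auto simp: ennreal_less_iff)
    then show "emeasure lborel (?S c) = c ^ DIM('a) * emeasure lborel (?T c)"
      using emeasure_cone_scale[OF gm r(2)] r by simp
  qed simp
  also have "\<dots> = (\<Sum>c\<in>range g. \<integral>\<^sup>+x. c ^ DIM('a) * indicator (?T c) x \<partial>lborel)"
    using cone_section_sets[OF gm] by (simp add: nn_integral_cmult_indicator)
  also have "\<dots> = (\<integral>\<^sup>+x. (\<Sum>c\<in>range g. c ^ DIM('a) * indicator (?T c) x) \<partial>lborel)"
    by (rule nn_integral_sum[symmetric]) (use cone_section_sets[OF gm] in simp)
  also have "(\<lambda>x. \<Sum>c\<in>range g. c ^ DIM('a) * indicator (?T c) x)
    = (\<lambda>x. g (sgn x) ^ DIM('a) * indicator (ball 0 1 - {0}) x)"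
  proof
    fix x
    have "(\<Sum>c\<in>range g. c ^ DIM('a) * indicator (?T c) x)
        = (\<Sum>c\<in>range g. if c = g (sgn x) then c ^ DIM('a) * indicator (ball 0 1 - {0}) x else 0)"
      by (intro sum.cong) (auto simp: indicator_def)
    then show "(\<Sum>c\<in>range g. c ^ DIM('a) * indicator (?T c) x)
        = g (sgn x) ^ DIM('a) * indicator (ball 0 1 - {0}) x"
      by (simp add: fr)
  qed
  finally show ?thesis .
qed

text \<open>Multiplication on \<open>ennreal\<close> is discontinuous at the pair of
  \<open>0\<close> and \<open>top\<close>; the induction works because \<open>a\<close> and
  \<open>a ^ n\<close> never form that pair.\<close>

lemma tendsto_power_ennreal:
  fixes f :: "'b \<Rightarrow> ennreal"
  assumes "(f \<longlongrightarrow> a) F"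
  shows "((\<lambda>x. f x ^ n) \<longlongrightarrow> a ^ n) F"
proof (induction n)
  case (Suc n)
  have "a ^ n = top \<Longrightarrow> a \<noteq> 0" "a ^ n = 0 \<Longrightarrow> a \<noteq> top"
    by (auto simp: power_eq_top_ennreal top_power_ennreal split: if_splits)
  then show ?case
    unfolding power_Suc using Suc assms by (intro tendsto_mult_ennreal) auto
qed simp

text \<open>Monotone convergence on both sides, from simple functions. The strict inequality in the
  description of the body matters: a point below the supremum of the \<open>g i\<close> is already
  below one of them, so the approximating bodies exhaust the limit body.\<close>

lemma emeasure_star:
  fixes f :: "'a::euclidean_space \<Rightarrow> ennreal"
  assumes f [measurable]: "f \<in> borel_measurable borel"
  shows "emeasure lborel {x. x \<noteq> 0 \<and> ennreal (norm x) < f (sgn x)}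
    = (\<integral>\<^sup>+x. f (sgn x) ^ DIM('a) * indicator (ball 0 1 - {0}) x \<partial>lborel)"
proof -
  have [measurable]: "ball 0 1 - {0::'a} \<in> sets borel" by simp
  obtain g where g: "\<And>i. simple_function borel (g i)" "incseq g" "\<And>i x. g i x < top"
      "\<And>x. (SUP i. g i x) = f x"
    using borel_measurable_implies_simple_function_sequence'[OF f] by blast
  have [measurable]: "g i \<in> borel_measurable borel" for i
    using g(1) by (rule borel_measurable_simple_function)
  have gmono: "incseq (\<lambda>i. g i x)" for x
    using g(2) by (auto simp: incseq_def le_fun_def)
  let ?S = "\<lambda>h. {x. x \<noteq> 0 \<and> ennreal (norm x) < h (sgn x)}"
  have U: "?S f = (\<Union>i. ?S (g i))"
    by (auto simp: g(4)[symmetric] less_SUP_iff)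
  have inc: "incseq (\<lambda>i. ?S (g i))"
    using gmono by (fastforce simp: incseq_def intro: less_le_trans)
  have m: "?S (g i) \<in> sets lborel" for i by measurable
  have "emeasure lborel (?S f) = (SUP i. emeasure lborel (?S (g i)))"
    unfolding U using SUP_emeasure_incseq[OF _ inc] m by (simp add: image_subset_iff)
  also have "\<dots> = (SUP i. \<integral>\<^sup>+x. g i (sgn x) ^ DIM('a) * indicator (ball 0 1 - {0}) x \<partial>lborel)"
    using emeasure_star_simple[OF g(1,3)] by simp
  also have "\<dots> = (\<integral>\<^sup>+x. (SUP i. g i (sgn x) ^ DIM('a) * indicator (ball 0 1 - {0}) x) \<partial>lborel)"
    by (rule nn_integral_monotone_convergence_SUP[symmetric], use gmono in
        \<open>force simp: incseq_def le_fun_def intro!: mult_right_mono power_mono\<close>, measurable)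
  also have "(\<lambda>x. SUP i. g i (sgn x) ^ DIM('a) * indicator (ball 0 1 - {0}) x)
    = (\<lambda>x. f (sgn x) ^ DIM('a) * indicator (ball 0 1 - {0}) x)"
  proof
    fix x
    have "(\<lambda>i. g i (sgn x)) \<longlonglongrightarrow> f (sgn x)"
      using LIMSEQ_SUP[OF gmono, of "sgn x"] g(4) by simp
    then have lim: "(\<lambda>i. g i (sgn x) ^ DIM('a) * indicator (ball 0 1 - {0}) x) \<longlonglongrightarrow>
        f (sgn x) ^ DIM('a) * indicator (ball 0 1 - {0}) x"
      by (auto simp: indicator_def intro: tendsto_power_ennreal)
    have "incseq (\<lambda>i. g i (sgn x) ^ DIM('a) * indicator (ball 0 1 - {0}) x)"
      using gmono by (auto simp: incseq_def intro!: mult_right_mono power_mono)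
    from LIMSEQ_unique[OF LIMSEQ_SUP[OF this] lim]
    show "(SUP i. g i (sgn x) ^ DIM('a) * indicator (ball 0 1 - {0}) x)
        = f (sgn x) ^ DIM('a) * indicator (ball 0 1 - {0}) x" .
  qed
  finally show ?thesis .
qed

section \<open>Inclusion-exclusion and disjointness of caps\<close>

lemma sum_pairs_Suc:
  fixes f :: "nat \<Rightarrow> nat \<Rightarrow> real"
  shows "(\<Sum>i\<in>{1..Suc m}. \<Sum>j\<in>{i<..Suc m}. f i j)
    = (\<Sum>i\<in>{1..m}. \<Sum>j\<in>{i<..m}. f i j) + (\<Sum>i\<in>{1..m}. f i (Suc m))"
proof -
  have "{i<..Suc m} = insert (Suc m) {i<..m}" if "i \<in> {1..m}" for i
    using that by auto
  then have "(\<Sum>i\<in>{1..m}. \<Sum>j\<in>{i<..Suc m}. f i j)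
      = (\<Sum>i\<in>{1..m}. (\<Sum>j\<in>{i<..m}. f i j) + f i (Suc m))"
    by (intro sum.cong) (auto simp del: sum.lessThan_Suc)
  then show ?thesis
    by (simp add: sum.distrib)
qed

lemma sum_triples_Suc:
  fixes f :: "nat \<Rightarrow> nat \<Rightarrow> nat \<Rightarrow> real"
  shows "(\<Sum>i\<in>{1..Suc m}. \<Sum>j\<in>{i<..Suc m}. \<Sum>k\<in>{j<..Suc m}. f i j k)
    = (\<Sum>i\<in>{1..m}. \<Sum>j\<in>{i<..m}. \<Sum>k\<in>{j<..m}. f i j k)
      + (\<Sum>i\<in>{1..m}. \<Sum>j\<in>{i<..m}. f i j (Suc m))"
proof -
  have "{j<..Suc m} = insert (Suc m) {j<..m}" if "j \<le> m" for j
    using that by auto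
  then have "(\<Sum>i\<in>{1..m}. \<Sum>j\<in>{i<..m}. \<Sum>k\<in>{j<..Suc m}. f i j k)
      = (\<Sum>i\<in>{1..m}. \<Sum>j\<in>{i<..m}. (\<Sum>k\<in>{j<..m}. f i j k) + f i j (Suc m))"
    by (intro sum.cong) auto
  then show ?thesis
    by (subst sum_pairs_Suc) (simp add: sum.distrib)
qed

lemma prod_one_minus_no_pairs:
  fixes x :: "nat \<Rightarrow> real"
  assumes "\<And>i. x i \<in> {0, 1}" "\<And>i j. 1 \<le> i \<Longrightarrow> i < j \<Longrightarrow> j \<le> m \<Longrightarrow> x i * x j = 0"
  shows "(\<Prod>i\<in>{1..m}. 1 - x i) = 1 - (\<Sum>i\<in>{1..m}. x i)"
  using assms(2)
proof (induction m)
  case (Suc m)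
  have "x (Suc m) = 0 \<or> (x (Suc m) = 1 \<and> (\<forall>i\<in>{1..m}. x i = 0))"
    using assms(1)[of "Suc m"] Suc.prems[of _ "Suc m"] by auto
  then show ?case
    using Suc by (auto simp: algebra_simps)
qed simp

text \<open>When a new variable is 1, the product drops to 0 and the earlier variables satisfy the
  vanishing hypothesis one degree lower. Comparing the lower-degree formula with the induction
  hypothesis kills the top-degree sum over the earlier indices, and the remaining terms telescope to
  0. The version for quadruples repeats this one degree higher.\<close>

lemma prod_one_minus_no_triples:
  fixes x :: "nat \<Rightarrow> real"
  assumes "\<And>i. x i \<in> {0, 1}"
    and "\<And>i j k. 1 \<le> i \<Longrightarrow> i < j \<Longrightarrow> j < k \<Longrightarrow> k \<le> m \<Longrightarrow> x i * x j * x k = 0"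
  shows "(\<Prod>i\<in>{1..m}. 1 - x i) = 1 - (\<Sum>i\<in>{1..m}. x i) + (\<Sum>i\<in>{1..m}. \<Sum>j\<in>{i<..m}. x i * x j)"
  using assms(2)
proof (induction m)
  case (Suc m)
  have IH: "(\<Prod>i\<in>{1..m}. 1 - x i) = 1 - (\<Sum>i\<in>{1..m}. x i) + (\<Sum>i\<in>{1..m}. \<Sum>j\<in>{i<..m}. x i * x j)"
    using Suc by auto
  consider "x (Suc m) = 0" | "x (Suc m) = 1" using assms(1)[of "Suc m"] by auto
  then show ?case
  proof cases
    case 1
    with IH show ?thesis unfolding sum_pairs_Suc by simp
  next
    case 2
    have "x i * x j = 0" if "1 \<le> i" "i < j" "j \<le> m" for i j
      using Suc.prems[of i j "Suc m"] that 2 by auto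
    from prod_one_minus_no_pairs[OF assms(1) this]
    have "(\<Prod>i\<in>{1..m}. 1 - x i) = 1 - (\<Sum>i\<in>{1..m}. x i)" by simp
    with 2 IH show ?thesis unfolding sum_pairs_Suc by simp
  qed
qed simp

lemma prod_one_minus_no_quadruples:
  fixes x :: "nat \<Rightarrow> real"
  assumes "\<And>i. x i \<in> {0, 1}"
    and "\<And>i j k l. 1 \<le> i \<Longrightarrow> i < j \<Longrightarrow> j < k \<Longrightarrow> k < l \<Longrightarrow> l \<le> m \<Longrightarrow> x i * x j * x k * x l = 0"
  shows "(\<Prod>i\<in>{1..m}. 1 - x i) = 1 - (\<Sum>i\<in>{1..m}. x i) + (\<Sum>i\<in>{1..m}. \<Sum>j\<in>{i<..m}. x i * x j)
    - (\<Sum>i\<in>{1..m}. \<Sum>j\<in>{i<..m}. \<Sum>k\<in>{j<..m}. x i * x j * x k)"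
  using assms(2)
proof (induction m)
  case (Suc m)
  have IH: "(\<Prod>i\<in>{1..m}. 1 - x i) = 1 - (\<Sum>i\<in>{1..m}. x i) + (\<Sum>i\<in>{1..m}. \<Sum>j\<in>{i<..m}. x i * x j)
      - (\<Sum>i\<in>{1..m}. \<Sum>j\<in>{i<..m}. \<Sum>k\<in>{j<..m}. x i * x j * x k)"
    using Suc by auto
  consider "x (Suc m) = 0" | "x (Suc m) = 1" using assms(1)[of "Suc m"] by auto
  then show ?case
  proof cases
    case 1
    with IH show ?thesis unfolding sum_triples_Suc unfolding sum_pairs_Suc by simp
  next
    case 2
    have "x i * x j * x k = 0" if "1 \<le> i" "i < j" "j < k" "k \<le> m" for i j k
      using Suc.prems[of i j k "Suc m"] that 2 by auto
    from prod_one_minus_no_triples[OF assms(1) this]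
    have "(\<Prod>i\<in>{1..m}. 1 - x i) = 1 - (\<Sum>i\<in>{1..m}. x i) + (\<Sum>i\<in>{1..m}. \<Sum>j\<in>{i<..m}. x i * x j)"
      by simp
    with 2 IH show ?thesis unfolding sum_triples_Suc unfolding sum_pairs_Suc by simp
  qed
qed simp

text \<open>The identity holds pointwise for the indicator functions and is then integrated. Working
  with \<open>has_bochner_integral\<close> carries integrability and value together through the
  nested sums.\<close>

lemma (in finite_measure) measure_compl_no_quadruples:
  fixes A :: "nat \<Rightarrow> 'a set"
  assumes A: "\<And>i. i \<in> {1..m} \<Longrightarrow> A i \<in> sets M"
    and empty: "\<And>i j k l. 1 \<le> i \<Longrightarrow> i < j \<Longrightarrow> j < k \<Longrightarrow> k < l \<Longrightarrow> l \<le> m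
      \<Longrightarrow> A i \<inter> A j \<inter> A k \<inter> A l = {}"
  shows "measure M (space M - (\<Union>i\<in>{1..m}. A i)) = measure M (space M) - (\<Sum>i\<in>{1..m}. measure M (A i))
    + (\<Sum>i\<in>{1..m}. \<Sum>j\<in>{i<..m}. measure M (A i \<inter> A j))
    - (\<Sum>i\<in>{1..m}. \<Sum>j\<in>{i<..m}. \<Sum>k\<in>{j<..m}. measure M (A i \<inter> A j \<inter> A k))"
proof -
  have hb: "has_bochner_integral M (indicator B) (measure M B)" if "B \<in> sets M" for B
    using that by (intro has_bochner_integral_real_indicator) (auto simp: less_top[symmetric])
  have hb1: "has_bochner_integral M (indicator (A i)) (measure M (A i))" if "i \<in> {1..m}" for i
    by (intro hb A that)
  have hb2: "has_bochner_integral M (indicator (A i \<inter> A j)) (measure M (A i \<inter> A j))"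
    if "i \<in> {1..m}" "j \<in> {i<..m}" for i j
    using that by (intro hb sets.Int A) auto
  have hb3: "has_bochner_integral M (indicator (A i \<inter> A j \<inter> A k)) (measure M (A i \<inter> A j \<inter> A k))"
    if "i \<in> {1..m}" "j \<in> {i<..m}" "k \<in> {j<..m}" for i j k
    using that by (intro hb sets.Int A) auto
  have pt: "indicator (space M - (\<Union>i\<in>{1..m}. A i)) x = (1::real) - (\<Sum>i\<in>{1..m}. indicator (A i) x)
    + (\<Sum>i\<in>{1..m}. \<Sum>j\<in>{i<..m}. indicator (A i \<inter> A j) x)
    - (\<Sum>i\<in>{1..m}. \<Sum>j\<in>{i<..m}. \<Sum>k\<in>{j<..m}. indicator (A i \<inter> A j \<inter> A k) x)"
    if "x \<in> space M" for x
  proof -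
    have "indicator (space M - (\<Union>i\<in>{1..m}. A i)) x = (\<Prod>i\<in>{1..m}. 1 - indicator (A i) x :: real)"
    proof (cases "\<exists>i\<in>{1..m}. x \<in> A i")
      case True
      then have "(\<Prod>i\<in>{1..m}. 1 - indicator (A i) x :: real) = 0"
        by (intro prod_zero) (auto intro: bexI simp: indicator_def)
      with True show ?thesis by auto
    qed (use that in \<open>auto simp: indicator_def\<close>)
    also have "\<dots> = 1 - (\<Sum>i\<in>{1..m}. indicator (A i) x)
      + (\<Sum>i\<in>{1..m}. \<Sum>j\<in>{i<..m}. indicator (A i) x * indicator (A j) x)
      - (\<Sum>i\<in>{1..m}. \<Sum>j\<in>{i<..m}. \<Sum>k\<in>{j<..m}. indicator (A i) x * indicator (A j) x * indicator (A k) x)"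
    proof (rule prod_one_minus_no_quadruples)
      fix i j k l assume "1 \<le> i" "i < j" "j < k" "k < l" "l \<le> m"
      then show "indicator (A i) x * indicator (A j) x * indicator (A k) x * indicator (A l) x = (0::real)"
        using empty[of i j k l] by (auto simp: indicator_def)
    qed (auto simp: indicator_def)
    finally show ?thesis by (simp add: indicator_inter_arith)
  qed
  have "has_bochner_integral M (\<lambda>x. indicator (space M) x - (\<Sum>i\<in>{1..m}. indicator (A i) x)
    + (\<Sum>i\<in>{1..m}. \<Sum>j\<in>{i<..m}. indicator (A i \<inter> A j) x)
    - (\<Sum>i\<in>{1..m}. \<Sum>j\<in>{i<..m}. \<Sum>k\<in>{j<..m}. indicator (A i \<inter> A j \<inter> A k) x))
    (measure M (space M) - (\<Sum>i\<in>{1..m}. measure M (A i))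
    + (\<Sum>i\<in>{1..m}. \<Sum>j\<in>{i<..m}. measure M (A i \<inter> A j))
    - (\<Sum>i\<in>{1..m}. \<Sum>j\<in>{i<..m}. \<Sum>k\<in>{j<..m}. measure M (A i \<inter> A j \<inter> A k)))"
    by (intro has_bochner_integral_diff has_bochner_integral_add has_bochner_integral_sum
        hb1 hb2 hb3 hb[OF sets.top])
  also have "?this \<longleftrightarrow> has_bochner_integral M (indicator (space M - (\<Union>i\<in>{1..m}. A i)))
    (measure M (space M) - (\<Sum>i\<in>{1..m}. measure M (A i))
    + (\<Sum>i\<in>{1..m}. \<Sum>j\<in>{i<..m}. measure M (A i \<inter> A j))
    - (\<Sum>i\<in>{1..m}. \<Sum>j\<in>{i<..m}. \<Sum>k\<in>{j<..m}. measure M (A i \<inter> A j \<inter> A k)))"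
    by (intro has_bochner_integral_cong) (simp_all only: pt indicator_simps refl)
  finally show ?thesis
    using hb[of "space M - (\<Union>i\<in>{1..m}. A i)"] A
    by (intro has_bochner_integral_eq[OF hb]) (auto intro!: sets.Diff sets.finite_UN)
qed

section \<open>When several caps can have a common point\<close>

lemma inner_sum_four_le:
  fixes a b c d \<theta> :: "'a::real_inner"
  assumes "norm a = 1" "norm b = 1" "norm c = 1" "norm d = 1" "norm \<theta> = 1"
    and "a \<bullet> b \<le> 1/2" "a \<bullet> c \<le> 1/2" "a \<bullet> d \<le> 1/2" "b \<bullet> c \<le> 1/2" "b \<bullet> d \<le> 1/2" "c \<bullet> d \<le> 1/2"
  shows "\<theta> \<bullet> (a + b + c + d) \<le> sqrt 10"
proof -
  have "(norm (a + b + c + d))\<^sup>2 \<le> 10"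
    using assms by (simp add: power2_norm_eq_inner inner_simps norm_eq_1 inner_commute)
  then have "norm (a + b + c + d) \<le> sqrt 10" by (rule real_le_rsqrt)
  then show ?thesis
    using norm_cauchy_schwarz[of \<theta> "a + b + c + d"] assms(5) by simp
qed

lemma inner_sum_three_le:
  fixes a b c \<theta> :: "'a::real_inner"
  assumes "norm a = 1" "norm b = 1" "norm c = 1" "norm \<theta> = 1"
    and "a \<bullet> b \<le> 1/2" "a \<bullet> c \<le> 1/2" "b \<bullet> c \<le> 1/2"
  shows "\<theta> \<bullet> (a + b + c) \<le> sqrt 6"
proof -
  have "(norm (a + b + c))\<^sup>2 \<le> 6"
    using assms by (simp add: power2_norm_eq_inner inner_simps norm_eq_1 inner_commute)
  then have "norm (a + b + c) \<le> sqrt 6" by (rule real_le_rsqrt)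
  then show ?thesis
    using norm_cauchy_schwarz[of \<theta> "a + b + c"] assms(4) by simp
qed

lemma inner_ge_cos_of_ang_le:
  assumes "norm \<theta> = 1" "norm w = 1" "ang \<theta> w \<le> r" "r \<le> pi"
  shows "cos r \<le> \<theta> \<bullet> w"
proof -
  have b: "\<bar>\<theta> \<bullet> w\<bar> \<le> 1" using Cauchy_Schwarz_ineq2[of \<theta> w] assms by simp
  then have "cos r \<le> cos (arccos (\<theta> \<bullet> w))"
    using assms by (intro cos_monotone_0_pi_le) (auto simp: ang_def arccos_lbound)
  then show ?thesis using b by simp
qed

lemma ang_gt_iff:
  assumes "norm \<theta> = 1" "norm w = 1" "0 \<le> r" "r \<le> pi"
  shows "r < ang \<theta> w \<longleftrightarrow> \<theta> \<bullet> w < cos r"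
proof -
  have b: "\<bar>\<theta> \<bullet> w\<bar> \<le> 1" using Cauchy_Schwarz_ineq2[of \<theta> w] assms by simp
  then have "r < arccos (\<theta> \<bullet> w) \<longleftrightarrow> cos (arccos (\<theta> \<bullet> w)) < cos r"
    using assms by (intro cos_mono_less_eq[symmetric]) (auto simp: arccos_lbound arccos_ubound)
  then show ?thesis using b by (simp add: ang_def)
qed

lemma r4_bounds: "0 < r4" "r4 < pi / 2"
proof -
  have "arcsin 0 < r4" unfolding r4_def by (rule arcsin_less_arcsin) (auto simp: real_le_lsqrt)
  moreover have "r4 < arcsin 1" unfolding r4_def
    by (rule arcsin_less_arcsin) (auto intro: order_trans[of _ 0])
  ultimately show "0 < r4" "r4 < pi / 2" by auto
qed

lemma sin_r4: "sin r4 = sqrt (3/8)" and cos_r4: "cos r4 = sqrt (5/8)"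
proof -
  have b: "sqrt (3/8) \<le> 1" "-1 \<le> sqrt (3/8)" by (auto intro: order_trans[of _ 0])
  show "sin r4 = sqrt (3/8)" unfolding r4_def using b by simp
  have "cos r4 = sqrt (1 - (sqrt (3/8))\<^sup>2)" unfolding r4_def using b by (intro cos_arcsin) auto
  then show "cos r4 = sqrt (5/8)" by simp
qed

lemma cos_r_star: "cos r_star = sqrt (2/3)"
proof -
  have b: "1 / sqrt 3 \<le> 1" "-1 \<le> 1 / sqrt 3" by (auto intro: order_trans[of _ 0])
  have "cos r_star = sqrt (1 - (1 / sqrt 3)\<^sup>2)" unfolding r_star_def using b by (intro cos_arcsin) auto
  then show ?thesis by (simp add: power_divide)
qed

lemma r_star_less_r4: "r_star < r4"
  unfolding r_star_def r4_def
proof (rule arcsin_less_arcsin)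
  show "1 / sqrt 3 < sqrt (3/8)"
    by (rule real_less_rsqrt) (simp add: power_divide)
  show "-1 \<le> 1 / sqrt 3" by (rule order_trans[of _ 0]) simp_all
qed simp

lemma four_caps_disjoint:
  assumes W: "contact_configuration W" and abcd: "a \<in> W" "b \<in> W" "c \<in> W" "d \<in> W"
    and ne: "a \<noteq> b" "a \<noteq> c" "a \<noteq> d" "b \<noteq> c" "b \<noteq> d" "c \<noteq> d" and r: "0 \<le> r" "r < r4"
  shows "cap r a \<inter> cap r b \<inter> cap r c \<inter> cap r d = {}"
proof (rule ccontr)
  assume "cap r a \<inter> cap r b \<inter> cap r c \<inter> cap r d \<noteq> {}"
  then obtain \<theta> where \<theta>: "norm \<theta> = 1" "ang \<theta> a \<le> r" "ang \<theta> b \<le> r" "ang \<theta> c \<le> r" "ang \<theta> d \<le> r"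
    by (auto simp: cap_def)
  have n: "norm a = 1" "norm b = 1" "norm c = 1" "norm d = 1"
    using W abcd by (auto simp: contact_configuration_def)
  have rpi: "r \<le> pi" using r r4_bounds by auto
  have "4 * cos r \<le> \<theta> \<bullet> (a + b + c + d)"
    using
      inner_ge_cos_of_ang_le[OF \<theta>(1) n(1) \<theta>(2) rpi] inner_ge_cos_of_ang_le[OF \<theta>(1) n(2) \<theta>(3) rpi]
      inner_ge_cos_of_ang_le[OF \<theta>(1) n(3) \<theta>(4) rpi] inner_ge_cos_of_ang_le[OF \<theta>(1) n(4) \<theta>(5) rpi]
    by (simp add: inner_add_right)
  also have "\<dots> \<le> sqrt 10"
    by (rule inner_sum_four_le) (use W abcd ne n \<theta> in \<open>auto simp: contact_configuration_def\<close>)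
  \<comment> \<open>This equality is the origin of \<open>r4\<close>: it is the radius at which the
    bound for four caps becomes tight.\<close>
  also have "sqrt 10 = 4 * cos r4"
    by (rule real_sqrt_unique) (auto simp: cos_r4 power_mult_distrib)
  finally have "cos r \<le> cos r4" by simp
  moreover have "cos r4 < cos r" using r r4_bounds by (intro cos_monotone_0_pi) auto
  ultimately show False by simp
qed

lemma three_caps_disjoint:
  assumes W: "contact_configuration W" and abc: "a \<in> W" "b \<in> W" "c \<in> W"
    and ne: "a \<noteq> b" "a \<noteq> c" "b \<noteq> c" and r: "0 \<le> r" "r < r_star"
  shows "cap r a \<inter> cap r b \<inter> cap r c = {}"
proof (rule ccontr)
  assume "cap r a \<inter> cap r b \<inter> cap r c \<noteq> {}"
  then obtain \<theta> where \<theta>: "norm \<theta> = 1" "ang \<theta> a \<le> r" "ang \<theta> b \<le> r" "ang \<theta> c \<le> r"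
    by (auto simp: cap_def)
  have n: "norm a = 1" "norm b = 1" "norm c = 1"
    using W abc by (auto simp: contact_configuration_def)
  have rpi: "r \<le> pi" "r_star \<le> pi" using r r4_bounds r_star_less_r4 by auto
  have "3 * cos r \<le> \<theta> \<bullet> (a + b + c)"
    using inner_ge_cos_of_ang_le[OF \<theta>(1) n(1) \<theta>(2) rpi(1)] inner_ge_cos_of_ang_le[OF \<theta>(1) n(2) \<theta>(3) rpi(1)]
      inner_ge_cos_of_ang_le[OF \<theta>(1) n(3) \<theta>(4) rpi(1)]
    by (simp add: inner_add_right)
  also have "\<dots> \<le> sqrt 6"
    by (rule inner_sum_three_le) (use W abc ne n \<theta> in \<open>auto simp: contact_configuration_def\<close>)
  \<comment> \<open>The same threshold for three caps, which is the origin of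
    \<open>r_star\<close>.\<close>
  also have "sqrt 6 = 3 * cos r_star"
    by (rule real_sqrt_unique) (auto simp: cos_r_star power_mult_distrib)
  finally have "cos r \<le> cos r_star" by simp
  moreover have "cos r_star < cos r" using r rpi by (intro cos_monotone_0_pi) auto
  ultimately show False by simp
qed

section \<open>Rotation invariance\<close>

text \<open>The map is the reflection in the hyperplane orthogonal to \<open>v - v'\<close>. The
  last clause, that it fixes every vector with equal inner products with \<open>v\<close> and
  \<open>v'\<close>, is what lets such moves be composed without disturbing vectors already in
  place.\<close>

lemma orthogonal_transformation_move:
  fixes v v' :: "'a::real_inner"
  assumes "norm v = norm v'"
  obtains f where "orthogonal_transformation f" "f v = v'" "\<And>x. x \<bullet> v = x \<bullet> v' \<Longrightarrow> f x = x"
proof (cases "v = v'")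
  case True
  then show ?thesis by (intro that[of "\<lambda>x. x"]) (auto simp: orthogonal_transformation_def linear_iff)
next
  case False
  define a where "a = v - v'"
  define f where "f x = x - (2 * (x \<bullet> a) / (a \<bullet> a)) *\<^sub>R a" for x
  have a: "a \<bullet> a \<noteq> 0" using False by (simp add: a_def)
  have "v \<bullet> v = v' \<bullet> v'" using assms by (simp add: norm_eq)
  \<comment> \<open>Equal norms make \<open>v\<close> project onto half of \<open>a\<close>, so the
    reflection subtracts exactly \<open>a = v - v'\<close> from \<open>v\<close>.\<close>
  then have va: "2 * (v \<bullet> a) = a \<bullet> a"
    by (simp add: a_def inner_simps inner_commute)
  show ?thesis
  proof (rule that)
    have "linear f"
      unfolding f_def
      by (intro linearI) (simp_all add: inner_simps algebra_simps add_divide_distrib)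
    moreover have "f x \<bullet> f y = x \<bullet> y" for x y
    proof -
      define p q where "p = x \<bullet> a / (a \<bullet> a)" and "q = y \<bullet> a / (a \<bullet> a)"
      have pq: "x \<bullet> a = p * (a \<bullet> a)" "a \<bullet> y = q * (a \<bullet> a)"
        using a by (simp_all add: p_def q_def inner_commute)
      have "f x = x - (2 * p) *\<^sub>R a" "f y = y - (2 * q) *\<^sub>R a"
        by (simp_all add: f_def p_def q_def)
      then show ?thesis
        by (simp only: inner_diff_left inner_diff_right inner_scaleR_left inner_scaleR_right pq)
          (simp add: algebra_simps)
    qed
    ultimately show "orthogonal_transformation f"
      by (simp add: orthogonal_transformation_def)
    have "2 * (v \<bullet> a) / (a \<bullet> a) = 1" using va a by simp
    then show "f v = v'" unfolding f_def by (simp only: scaleR_one) (simp add: a_def)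
    show "f x = x" if "x \<bullet> v = x \<bullet> v'" for x using that by (simp add: f_def a_def inner_simps)
  qed
qed

text \<open>The vectors are moved one at a time. Agreement of the prescribed inner products says
  precisely that the vectors already placed lie in the mirror of the next reflection, so they stay
  fixed.\<close>

lemma orthogonal_transformation_of_triples:
  fixes u v w u' v' w' :: "'a::real_inner"
  assumes "norm u = norm u'" "norm v = norm v'" "norm w = norm w'"
    and "u \<bullet> v = u' \<bullet> v'" "u \<bullet> w = u' \<bullet> w'" "v \<bullet> w = v' \<bullet> w'"
  obtains f where "orthogonal_transformation f" "f u = u'" "f v = v'" "f w = w'"
proof -
  obtain f1 where f1: "orthogonal_transformation f1" "f1 u = u'"
    using orthogonal_transformation_move[OF assms(1)] by blast
  have i1: "f1 x \<bullet> f1 y = x \<bullet> y" for x y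
    using f1(1) by (simp add: orthogonal_transformation_def)
  have "norm (f1 v) = norm v'" using assms by (simp add: norm_eq_sqrt_inner i1)
  then obtain f2 where f2: "orthogonal_transformation f2" "f2 (f1 v) = v'"
      "\<And>x. x \<bullet> f1 v = x \<bullet> v' \<Longrightarrow> f2 x = x"
    using orthogonal_transformation_move by blast
  have i2: "f2 x \<bullet> f2 y = x \<bullet> y" for x y
    using f2(1) by (simp add: orthogonal_transformation_def)
  have f2u: "f2 u' = u'"
    using i1[of u v] assms(4) by (intro f2(3)) (simp add: f1)
  have "norm (f2 (f1 w)) = norm w'" using assms by (simp add: norm_eq_sqrt_inner i1 i2)
  then obtain f3 where f3: "orthogonal_transformation f3" "f3 (f2 (f1 w)) = w'"
      "\<And>x. x \<bullet> f2 (f1 w) = x \<bullet> w' \<Longrightarrow> f3 x = x"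
    using orthogonal_transformation_move by blast
  have "f3 u' = u'"
    using i2[of "f1 u" "f1 w"] i1[of u w] assms(5) by (intro f3(3)) (simp add: f1 f2u)
  moreover have "f3 v' = v'"
    using i2[of "f1 v" "f1 w"] i1[of v w] assms(6) by (intro f3(3)) (simp add: f2)
  ultimately show ?thesis
    using f1 f2 f2u f3 by (intro that[of "f3 \<circ> (f2 \<circ> f1)"]) (auto intro: orthogonal_transformation_compose)
qed

section \<open>Caps and their measure under isometries\<close>

lemma closed_cap:
  assumes "norm w = 1"
  shows "closed (cap r w)"
proof -
  \<comment> \<open>Clamping the inner product to [-1, 1] changes nothing on the sphere and makes
    the composition with \<open>arccos\<close> continuous on the whole space.\<close>
  have "cap r w = sphere 0 1 \<inter> {\<theta>. arccos (max (-1) (min 1 (\<theta> \<bullet> w))) \<le> r}"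
  proof -
    have "max (-1) (min 1 (\<theta> \<bullet> w)) = \<theta> \<bullet> w" if "norm \<theta> = 1" for \<theta>
      using Cauchy_Schwarz_ineq2[of \<theta> w] that assms by (auto simp: abs_le_iff)
    then show ?thesis by (auto simp: cap_def ang_def)
  qed
  moreover have "closed {\<theta>. arccos (max (-1) (min 1 (\<theta> \<bullet> w))) \<le> r}"
    by (intro closed_Collect_le continuous_intros ballI) auto
  ultimately show ?thesis
    by (simp add: closed_Int)
qed

text \<open>An isometry commutes with \<open>sgn\<close>, so the cone over the image is the image of
  the cone, and Lebesgue measure is invariant under orthogonal maps.\<close>

lemma sigma3_orthogonal_image:
  fixes f :: "real^4 \<Rightarrow> real^4"
  assumes f: "orthogonal_transformation f" and A: "A \<in> sets borel" "A \<subseteq> sphere 0 1"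
  shows "sigma3 (f ` A) = sigma3 A"
proof -
  have lin: "linear f" and inj: "inj f" and surj: "surj f"
    using f by (auto simp: orthogonal_transformation_linear orthogonal_transformation_inj
        orthogonal_transformation_surj)
  have nf: "norm (f x) = norm x" for x using f by (rule orthogonal_transformation_norm)
  have sgnf: "sgn (f x) = f (sgn x)" for x
    using lin by (simp add: sgn_div_norm nf linear_cmul)
  obtain g where g: "orthogonal_transformation g" "\<And>x. g (f x) = x" "\<And>x. f (g x) = x"
    using orthogonal_transformation_inv[OF f] surj inj
    by (metis inv_f_f surj_f_inv_f)
  \<comment> \<open>Rewriting the image as a preimage under the inverse isometry is what shows that
    it is Borel.\<close>
  have "f ` A = g -` A"
    by (auto simp: g image_iff intro!: bexI[of _ "g _"])
  moreover have "g -` A \<in> sets borel"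
    using measurable_sets_borel[OF borel_measurable_continuous_onI A(1), of g]
      linear_continuous_on[OF linear_linear[THEN iffD2, OF orthogonal_transformation_linear[OF g(1)]]] by auto
  ultimately have fA: "f ` A \<in> sets borel" by simp
  have fA': "f ` A \<subseteq> sphere 0 1"
    using A(2) by (auto simp: nf)
  have img: "{x \<in> ball 0 1 - {0}. sgn x \<in> f ` A} = f ` {x \<in> ball 0 1 - {0}. sgn x \<in> A}" (is "?L = f ` ?R")
  proof (intro set_eqI iffI)
    fix x assume x: "x \<in> ?L"
    obtain y where y: "x = f y" using surj by blast
    have "y \<noteq> 0" using x y lin by (auto simp: linear_0)
    moreover have "sgn y \<in> A" using x y sgnf inj by (auto simp: inj_image_mem_iff)
    ultimately have "y \<in> ?R" using x y by (auto simp: nf)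
    then show "x \<in> f ` ?R" using y by blast
  next
    fix x assume "x \<in> f ` ?R"
    then show "x \<in> ?L" using linear_injective_0[OF lin] inj by (auto simp: nf sgnf)
  qed
  have bR: "?R \<in> sets borel" and bL: "?L \<in> sets borel" using cone_section_sets A fA by blast+
  have "?R \<in> lmeasurable"
    using bR by (intro bounded_set_imp_lmeasurable bounded_subset[OF bounded_ball[of 0 1]]) (auto simp: sets_completionI_sets)
  then have "measure lebesgue (f ` ?R) = measure lebesgue ?R"
    by (rule measure_orthogonal_image[OF f])
  then have "measure lborel ?L = measure lborel ?R"
    using bR bL unfolding img[symmetric] by (simp add: measure_completion)
  then show ?thesis
    using A fA fA' by (simp add: measure_surface_measure)
qed

lemma cap_orthogonal_image:
  assumes f: "orthogonal_transformation f"
  shows "cap r (f w) = f ` cap r w"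
proof (intro set_eqI iffI)
  fix x assume x: "x \<in> cap r (f w)"
  obtain y where "x = f y" using orthogonal_transformation_surj[OF f] by blast
  with x f show "x \<in> f ` cap r w"
    by (auto simp: cap_def ang_def orthogonal_transformation_def norm_eq_sqrt_inner)
next
  fix x assume "x \<in> f ` cap r w"
  with f show "x \<in> cap r (f w)"
    by (auto simp: cap_def ang_def orthogonal_transformation_def norm_eq_sqrt_inner)
qed

lemma cap_subset_sphere: "cap r w \<subseteq> sphere 0 1"
  by (auto simp: cap_def)

lemma cap_sets: "norm w = 1 \<Longrightarrow> cap r w \<in> sets borel"
  by (simp add: closed_cap borel_closed)

lemma ang_eq_iff:
  fixes u v u' v' :: "'a::real_inner"
  assumes "norm u = 1" "norm v = 1" "norm u' = 1" "norm v' = 1"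
  shows "ang u v = ang u' v' \<longleftrightarrow> u \<bullet> v = u' \<bullet> v'"
proof -
  have "\<bar>u \<bullet> v\<bar> \<le> 1" "\<bar>u' \<bullet> v'\<bar> \<le> 1"
    using Cauchy_Schwarz_ineq2[of u v] Cauchy_Schwarz_ineq2[of u' v'] assms by auto
  then show ?thesis by (simp add: ang_def arccos_eq_iff)
qed

lemma sigma3_three_caps_eq:
  assumes "norm u = 1" "norm v = 1" "norm w = 1" "norm u' = 1" "norm v' = 1" "norm w' = 1"
    and "ang u v = ang u' v'" "ang u w = ang u' w'" "ang v w = ang v' w'"
  shows "sigma3 (cap r u \<inter> cap r v \<inter> cap r w) = sigma3 (cap r u' \<inter> cap r v' \<inter> cap r w')"
proof -
  obtain f where f: "orthogonal_transformation f" "f u = u'" "f v = v'" "f w = w'"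
    using orthogonal_transformation_of_triples[of u u' v v' w w'] assms by (auto simp: ang_eq_iff)
  have "inj f" using f(1) by (rule orthogonal_transformation_inj)
  then have "cap r u' \<inter> cap r v' \<inter> cap r w' = f ` (cap r u \<inter> cap r v \<inter> cap r w)"
    using f cap_orthogonal_image[OF f(1)] by (metis image_Int)
  then show ?thesis
    using sigma3_orthogonal_image[OF f(1), of "cap r u \<inter> cap r v \<inter> cap r w"]
      assms cap_sets[of u r] cap_sets[of v r] cap_sets[of w r] cap_subset_sphere[of r u]
      by (auto simp: le_infI1)
qed

lemma Lam_eq:
  assumes "norm u = 1" "norm v = 1"
  shows "Lam r (ang u v) = sigma3 (cap r u \<inter> cap r v)"
  unfolding Lam_def
proof (rule the_equality)
  fix a assume "\<exists>u'\<in>sphere 0 1. \<exists>v'\<in>sphere 0 1. ang u' v' = ang u v \<and> a = sigma3 (cap r u' \<inter> cap r v')"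
  then obtain u' v' where *: "norm u' = 1" "norm v' = 1" "ang u' v' = ang u v"
      "a = sigma3 (cap r u' \<inter> cap r v')"
    by auto
  \<comment> \<open>A pair of caps is treated as a triple with its second centre repeated; this
    supplies the missing third angle.\<close>
  have "ang v' v' = ang v v" using * assms by (simp add: ang_def norm_eq_1)
  with sigma3_three_caps_eq[of u' v' v' u v v r] * assms
  show "a = sigma3 (cap r u \<inter> cap r v)" by (simp add: Int_assoc)
qed (rule bexI[of _ u], rule bexI[of _ v], use assms in simp_all)

lemma Lam3_eq:
  assumes "norm u = 1" "norm v = 1" "norm w = 1"
  shows "Lam3 r (ang u v) (ang u w) (ang v w) = sigma3 (cap r u \<inter> cap r v \<inter> cap r w)"
  unfolding Lam3_def
proof (rule the_equality)
  fix a assume "\<exists>u'\<in>sphere 0 1. \<exists>v'\<in>sphere 0 1. \<exists>w'\<in>sphere 0 1. ang u' v' = ang u v \<and>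
    ang u' w' = ang u w \<and> ang v' w' = ang v w \<and> a = sigma3 (cap r u' \<inter> cap r v' \<inter> cap r w')"
  then obtain u' v' w' where "norm u' = 1" "norm v' = 1" "norm w' = 1" "ang u' v' = ang u v"
    "ang u' w' = ang u w" "ang v' w' = ang v w" "a = sigma3 (cap r u' \<inter> cap r v' \<inter> cap r w')"
    by auto
  with sigma3_three_caps_eq[of u' v' w' u v w r] assms
  show "a = sigma3 (cap r u \<inter> cap r v \<inter> cap r w)" by simp
qed (rule bexI[of _ u], rule bexI[of _ v], rule bexI[of _ w], use assms in simp_all)

section \<open>Stieltjes integrals\<close>

definition stieltjes_measure :: "real \<Rightarrow> real \<Rightarrow> (real \<Rightarrow> real) \<Rightarrow> real measure" where
  "stieltjes_measure a b g = interval_measure (\<lambda>x. g (max a (min b x)))"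

lemma sets_stieltjes_measure [simp, measurable_cong]: "sets (stieltjes_measure a b g) = sets borel"
  by (simp add: stieltjes_measure_def)

lemma space_stieltjes_measure [simp]: "space (stieltjes_measure a b g) = UNIV"
  by (simp add: stieltjes_measure_def)

lemma stieltjes_integral_eq:
  "stieltjes_integral a b f g = (LINT x:{a<..b}|stieltjes_measure a b g. f x)"
  by (simp add: stieltjes_integral_def stieltjes_measure_def)

locale stieltjes =
  fixes a b :: real and g :: "real \<Rightarrow> real"
  assumes le: "a \<le> b" and mono: "mono_on {a..b} g" and cont: "continuous_on {a..b} g"
begin

lemma clamp_mono: "x \<le> y \<Longrightarrow> g (max a (min b x)) \<le> g (max a (min b y))"
  using le by (intro mono_onD[OF mono]) auto

lemma clamp_cont: "continuous_on UNIV (\<lambda>x. g (max a (min b x)))"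
  using le by (intro continuous_on_compose2[OF cont] continuous_intros) auto

lemma emeasure_Icc:
  "x \<le> y \<Longrightarrow> emeasure (stieltjes_measure a b g) {x..y} = g (max a (min b y)) - g (max a (min b x))"
  unfolding stieltjes_measure_def
  by (rule emeasure_interval_measure_Icc[OF _ clamp_mono clamp_cont])

lemma emeasure_Ioc:
  "x \<le> y \<Longrightarrow> emeasure (stieltjes_measure a b g) {x<..y} = g (max a (min b y)) - g (max a (min b x))"
  unfolding stieltjes_measure_def
  using clamp_mono clamp_cont
  by (intro emeasure_interval_measure_Ioc)
    (auto intro: continuous_within_subset simp: continuous_on_eq_continuous_within)

text \<open>Continuity of \<open>g\<close> rules out atoms, so open, half-open and closed intervals
  with the same ends have the same mass.\<close>

lemma null_singleton: "{x} \<in> null_sets (stieltjes_measure a b g)"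
  using emeasure_Icc[of x x] by auto

lemma emeasure_Ioo:
  assumes "x \<le> y"
  shows "emeasure (stieltjes_measure a b g) {x<..<y} = g (max a (min b y)) - g (max a (min b x))"
proof -
  have "emeasure (stieltjes_measure a b g) ({x<..y} - {y}) = emeasure (stieltjes_measure a b g) {x<..y}"
    by (rule emeasure_Diff_null_set) (auto simp: null_singleton)
  also have "{x<..y} - {y} = {x<..<y}" by auto
  finally show ?thesis using assms by (simp add: emeasure_Ioc)
qed

lemma sigma_finite: "sigma_finite_measure (stieltjes_measure a b g)"
  unfolding stieltjes_measure_def
  using clamp_mono clamp_cont
  by (intro sigma_finite_interval_measure)
    (auto intro: continuous_within_subset simp: continuous_on_eq_continuous_within)

lemma set_integrable_bounded:
  fixes f :: "real \<Rightarrow> real"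
  assumes [measurable]: "f \<in> borel_measurable borel" and "\<And>x. x \<in> {a<..b} \<Longrightarrow> \<bar>f x\<bar> \<le> B"
  shows "set_integrable (stieltjes_measure a b g) {a<..b} f"
  unfolding set_integrable_def
proof (rule integrableI_bounded_set[where A = "{a<..b}" and B = B])
  show "emeasure (stieltjes_measure a b g) {a<..b} < \<infinity>"
    using le by (simp add: emeasure_Ioc)
qed (use assms(2) in \<open>auto intro!: AE_I2 simp: indicator_def\<close>)

lemma has_bochner_integral_stieltjes_integral:
  fixes f :: "real \<Rightarrow> real"
  assumes "f \<in> borel_measurable borel" "\<And>x. x \<in> {a<..b} \<Longrightarrow> \<bar>f x\<bar> \<le> B"
  shows "has_bochner_integral (stieltjes_measure a b g) (\<lambda>x. indicator {a<..b} x *\<^sub>R f x)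
    (stieltjes_integral a b f g)"
  using set_integrable_bounded[OF assms]
  by (simp add: stieltjes_integral_eq set_lebesgue_integral_def set_integrable_def
      has_bochner_integral_integrable)

text \<open>The right end \<open>b\<close> carries no mass. This is needed because
  inclusion-exclusion describes \<open>U\<close> only for radii strictly below \<open>r4\<close>,
  whereas the integral runs over an interval containing \<open>r4\<close>.\<close>

lemma stieltjes_integral_cong_Ioo:
  fixes f h :: "real \<Rightarrow> real"
  assumes [measurable]: "f \<in> borel_measurable borel" "h \<in> borel_measurable borel"
    and eq: "\<And>x. a < x \<Longrightarrow> x < b \<Longrightarrow> f x = h x"
  shows "stieltjes_integral a b f g = stieltjes_integral a b h g"
  unfolding stieltjes_integral_eq
proof (rule set_lebesgue_integral_cong_AE)
  have "AE x in stieltjes_measure a b g. x \<noteq> b"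
    using AE_not_in[OF null_singleton[of b]] by auto
  then show "AE x\<in>{a<..b} in stieltjes_measure a b g. f x = h x"
    by eventually_elim (use eq in auto)
qed auto

end

text \<open>Half-open intervals generate the Borel sets and are closed under intersection, so it
  suffices to compare masses there; on them the fundamental theorem of calculus evaluates the
  density.\<close>

lemma stieltjes_measure_eq_density:
  assumes le: "a \<le> b" and [measurable]: "g' \<in> borel_measurable borel"
    and deriv: "\<And>x. a \<le> x \<Longrightarrow> x \<le> b \<Longrightarrow> (g has_real_derivative g' x) (at x)"
    and nonneg: "\<And>x. a \<le> x \<Longrightarrow> x \<le> b \<Longrightarrow> 0 \<le> g' x"
  shows "stieltjes a b g"
    and "stieltjes_measure a b g = density lborel (\<lambda>x. ennreal (g' x * indicator {a..b} x))" (is "?M = ?N")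
proof -
  show st: "stieltjes a b g"
  proof
    show "mono_on {a..b} g"
    proof (rule mono_onI)
      fix r s assume rs: "r \<in> {a..b}" "s \<in> {a..b}" "r \<le> s"
      have "\<exists>y. DERIV g x :> y \<and> 0 \<le> y" if "r \<le> x" "x \<le> s" for x
        using rs that by (intro exI[of _ "g' x"] conjI deriv nonneg) auto
      then show "g r \<le> g s"
        using rs(3) by (intro DERIV_nonneg_imp_nondecreasing[of r s g])
    qed
    show "continuous_on {a..b} g"
      using deriv by (auto intro!: continuous_at_imp_continuous_on DERIV_isCont)
  qed (fact le)
  interpret stieltjes a b g by fact
  show "?M = ?N"
  proof (rule measure_eqI_generator_eq[where E = "range (\<lambda>(c, d). {c<..d})" and \<Omega> = UNIV
        and A = "\<lambda>n. {- real n<..real n}"])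
    show "Int_stable (range (\<lambda>(c, d). {c<..d::real}))"
      by (auto simp: Int_stable_def intro!: image_eqI[of _ _ "(max _ _, min _ _)"])
    fix X assume "X \<in> range (\<lambda>(c, d). {c<..d::real})"
    then obtain c d where X: "X = {c<..d}" by auto
    show "emeasure ?M X = emeasure ?N X"
    proof (cases "c \<le> d")
      case True
      define c' where "c' = max a (min b c)"
      define d' where "d' = max a (min b d)"
      have cd: "a \<le> c'" "c' \<le> d'" "d' \<le> b" using True le by (auto simp: c'_def d'_def)
      have "emeasure ?N X = (\<integral>\<^sup>+x. ennreal (g' x * indicator {a..b} x) * indicator {c<..d} x \<partial>lborel)"
        unfolding X by (intro emeasure_density) auto
      also have "\<dots> = (\<integral>\<^sup>+x. ennreal (g' x) * indicator {c'..d'} x \<partial>lborel)"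
      proof (rule nn_integral_cong_AE)
        \<comment> \<open>Dropping the single point \<open>c'\<close> reconciles half-open with
          closed intervals, including the degenerate case in which \<open>{c<..d}\<close> misses
          \<open>{a..b}\<close> and the clamped ends coincide.\<close>
        have "AE x in lborel. x \<noteq> c'" by (rule AE_lborel_singleton)
        then show "AE x in lborel. ennreal (g' x * indicator {a..b} x) * indicator {c<..d} x
            = ennreal (g' x) * indicator {c'..d'} x"
          by eventually_elim
            (use True le in \<open>auto simp: indicator_def c'_def d'_def max_def min_def split: if_splits\<close>)
      qed
      also have "\<dots> = g d' - g c'"
        using cd deriv nonneg by (intro nn_integral_FTC_Icc) auto
      finally show ?thesis unfolding X emeasure_Ioc[OF True] by (simp add: c'_def d'_def)
    qed (simp add: X)
  next
    show "sets ?M = sigma_sets UNIV (range (\<lambda>(c, d). {c<..d}))"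
      by (simp add: borel_sigma_sets_Ioc)
    show "sets ?N = sigma_sets UNIV (range (\<lambda>(c, d). {c<..d}))"
      by (simp add: borel_sigma_sets_Ioc)
    show "range (\<lambda>n. {- real n<..real n}) \<subseteq> range (\<lambda>(c, d). {c<..d})" by auto
    show "(\<Union>n. {- real n<..real n}) = UNIV"
    proof (intro set_eqI iffI UNIV_I)
      fix x :: real
      obtain n where "\<bar>x\<bar> < real n" using reals_Archimedean2 by blast
      then show "x \<in> (\<Union>n. {- real n<..real n})" by (auto intro!: exI[of _ n])
    qed
    show "emeasure ?M {- real n<..real n} \<noteq> \<infinity>" for n
      by (simp add: emeasure_Ioc)
  qed auto
qed

text \<open>The density turns dg into g' dx, so an antiderivative \<open>F\<close> of the product
  \<open>f x * g' x\<close> evaluates the Stieltjes integral.\<close>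

lemma stieltjes_integral_FTC:
  assumes le: "a \<le> b" and [measurable]: "g' \<in> borel_measurable borel" "f \<in> borel_measurable borel"
    and deriv: "\<And>x. a \<le> x \<Longrightarrow> x \<le> b \<Longrightarrow> (g has_real_derivative g' x) (at x)"
    and nonneg: "\<And>x. a \<le> x \<Longrightarrow> x \<le> b \<Longrightarrow> 0 \<le> g' x"
    and deriv': "\<And>x. a \<le> x \<Longrightarrow> x \<le> b \<Longrightarrow> (F has_real_derivative f x * g' x) (at x)"
    and cont: "\<And>x. a \<le> x \<Longrightarrow> x \<le> b \<Longrightarrow> isCont (\<lambda>x. f x * g' x) x"
  shows "stieltjes_integral a b f g = F b - F a"
proof -
  have dens: "stieltjes_measure a b g = density lborel (\<lambda>x. ennreal (g' x * indicator {a..b} x))"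
    by (rule stieltjes_measure_eq_density(2)[OF le]) (use deriv nonneg in auto)
  have "stieltjes_integral a b f g
      = (\<integral>x. indicator {a<..b} x *\<^sub>R f x \<partial>density lborel (\<lambda>x. ennreal (g' x * indicator {a..b} x)))"
    unfolding stieltjes_integral_eq set_lebesgue_integral_def dens ..
  also have "\<dots> = (\<integral>x. (g' x * indicator {a..b} x) *\<^sub>R (indicator {a<..b} x *\<^sub>R f x) \<partial>lborel)"
    by (rule integral_density) (auto simp: indicator_def nonneg)
  also have "\<dots> = (\<integral>x. f x * g' x * indicator {a..b} x \<partial>lborel)"
  proof (rule integral_cong_AE)
    have "AE x in lborel. x \<noteq> a" by (rule AE_lborel_singleton)
    then show "AE x in lborel. (g' x * indicator {a..b} x) *\<^sub>R (indicator {a<..b} x *\<^sub>R f x)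
        = f x * g' x * indicator {a..b} x"
      by eventually_elim (auto simp: indicator_def)
  qed auto
  also have "\<dots> = F b - F a"
    by (rule integral_FTC_Icc_real[OF le deriv' cont])
  finally show ?thesis .
qed

section \<open>The integrator sec^4 and the cap function\<close>

lemma sec4_deriv:
  assumes "cos x \<noteq> 0"
  shows "(sec4 has_real_derivative 4 * sin x / cos x ^ 5) (at x)"
proof -
  have "((\<lambda>x. 1 / cos x ^ 4) has_real_derivative 4 * sin x / cos x ^ 5) (at x)"
    using assms by (auto intro!: derivative_eq_intros simp: field_simps power_numeral_reduce)
  then show ?thesis by (simp add: sec4_def[abs_def])
qed

lemma stieltjes_sec4:
  assumes "0 \<le> b" "b < pi / 2"
  shows "stieltjes 0 b sec4"
proof (rule stieltjes_measure_eq_density(1))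
  fix x assume "0 \<le> x" "x \<le> b"
  then have "0 < cos x" "0 \<le> sin x" using assms by (auto intro!: cos_gt_zero_pi sin_ge_zero)
  then show "(sec4 has_real_derivative 4 * sin x / cos x ^ 5) (at x)" "0 \<le> 4 * sin x / cos x ^ 5"
    by (auto intro: sec4_deriv)
qed (use assms in auto)

lemma C_deriv: "(C has_real_derivative 4 * pi * (sin x)\<^sup>2) (at x)"
proof -
  have "((\<lambda>x. pi * (2 * x - sin (2 * x))) has_real_derivative pi * (2 - 2 * cos (2 * x))) (at x)"
    by (auto intro!: derivative_eq_intros)
  also have "pi * (2 - 2 * cos (2 * x)) = 4 * pi * (sin x)\<^sup>2"
    unfolding cos_double_sin by (simp add: algebra_simps)
  finally show ?thesis by (simp add: C_def[abs_def])
qed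

lemma borel_measurable_C [measurable]: "C \<in> borel_measurable borel"
  unfolding C_def[abs_def] by measurable

text \<open>Integration by parts, where \<open>C' sec^4 = 4 pi tan^2 sec^2\<close> has the antiderivative
  \<open>(4 pi / 3) tan^3\<close>.\<close>

lemma stieltjes_integral_C:
  assumes "0 \<le> b" "b < pi / 2"
  shows "stieltjes_integral 0 b (\<lambda>r. \<alpha> - \<beta> * C r) sec4
    = \<alpha> * (sec4 b - 1) - \<beta> * (C b * sec4 b - 4 * pi / 3 * tan b ^ 3)"
proof -
  let ?F = "\<lambda>r. \<alpha> * sec4 r - \<beta> * (C r * sec4 r - 4 * pi / 3 * tan r ^ 3)"
  have "stieltjes_integral 0 b (\<lambda>r. \<alpha> - \<beta> * C r) sec4 = ?F b - ?F 0"
  proof (rule stieltjes_integral_FTC[where g' = "\<lambda>x. 4 * sin x / cos x ^ 5"])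
    fix x assume "0 \<le> x" "x \<le> b"
    then have pos: "0 < cos x" "0 \<le> sin x" using assms by (auto intro!: cos_gt_zero_pi sin_ge_zero)
    show "(sec4 has_real_derivative 4 * sin x / cos x ^ 5) (at x)" "0 \<le> 4 * sin x / cos x ^ 5"
      using pos by (auto intro: sec4_deriv)
    have "(?F has_real_derivative \<alpha> * (4 * sin x / cos x ^ 5)
        - \<beta> * (4 * pi * (sin x)\<^sup>2 * sec4 x + 4 * sin x / cos x ^ 5 * C x
          - 4 * pi / 3 * (3 * (tan x)\<^sup>2 * inverse ((cos x)\<^sup>2)))) (at x)"
      using pos by (auto intro!: derivative_eq_intros sec4_deriv C_deriv)
    also have "4 * pi / 3 * (3 * (tan x)\<^sup>2 * inverse ((cos x)\<^sup>2)) = 4 * pi * (sin x)\<^sup>2 * sec4 x"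
      by (simp add: tan_def sec4_def power_divide inverse_eq_divide flip: power_add)
    finally show "(?F has_real_derivative (\<alpha> - \<beta> * C x) * (4 * sin x / cos x ^ 5)) (at x)"
      by (simp add: left_diff_distrib mult.assoc mult.commute[of "C x"] diff_divide_distrib)
    show "isCont (\<lambda>x. (\<alpha> - \<beta> * C x) * (4 * sin x / cos x ^ 5)) x"
      using pos C_deriv[of x, THEN DERIV_isCont] by (intro continuous_intros) auto
  qed (use assms in auto)
  then show ?thesis by (simp add: C_def sec4_def algebra_simps)
qed

section \<open>Volume of the truncated cell\<close>

lemma null_sets_convex_frontier:
  fixes S :: "'a::euclidean_space set"
  assumes "convex S" "closed S"
  shows "S - interior S \<in> null_sets lborel"
proof -
  have "frontier S = S - interior S"
    using assms by (simp add: frontier_def closure_closed)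
  moreover have "negligible (frontier S)" using assms by (intro negligible_convex_frontier)
  moreover have "S - interior S \<in> sets borel" using assms by auto
  ultimately show ?thesis
    by (simp add: negligible_iff_null_sets null_sets_completion_iff)
qed

section \<open>The truncated cell as a star-shaped body\<close>

lemma convex_cell: "convex (cell W)" and closed_cell: "closed (cell W)"
proof -
  have c: "cell W = (\<Inter>w\<in>W. {x. w \<bullet> x \<le> 1})"
    by (auto simp: cell_def inner_commute)
  show "convex (cell W)" unfolding c by (intro convex_INT convex_halfspace_le)
  show "closed (cell W)" unfolding c by (intro closed_INT ballI closed_halfspace_le)
qed

text \<open>The reciprocal of the radial function of the truncated cell, restricted to the sphere.\<close>
definition cell_gauge :: "(real ^ 4) set \<Rightarrow> real \<Rightarrow> real ^ 4 \<Rightarrow> real" where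
  "cell_gauge W \<rho> \<theta> = Max (insert (1 / \<rho>) ((\<lambda>w. \<theta> \<bullet> w) ` W))"

context
  fixes W :: "(real ^ 4) set" and \<rho> :: real
  assumes fin: "finite W" and W: "W \<subseteq> sphere 0 1" and \<rho>: "1 \<le> \<rho>"
begin

lemma arccos_inverse_bounds:
  "0 \<le> arccos (1 / \<rho>)" "arccos (1 / \<rho>) < pi / 2" "cos (arccos (1 / \<rho>)) = 1 / \<rho>"
proof -
  have r1: "0 < 1 / \<rho>" "1 / \<rho> \<le> 1" using \<rho> by auto
  show "0 \<le> arccos (1 / \<rho>)" using r1 by (intro arccos_lbound) linarith+
  show "cos (arccos (1 / \<rho>)) = 1 / \<rho>" using r1 by (intro cos_arccos) linarith+
  show "arccos (1 / \<rho>) < pi / 2" using r1 arccos_less_arccos[of 0 "1 / \<rho>"] by simp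
qed

lemma cell_gauge_less_iff: "cell_gauge W \<rho> \<theta> < t \<longleftrightarrow> 1 / \<rho> < t \<and> (\<forall>w\<in>W. \<theta> \<bullet> w < t)"
  unfolding cell_gauge_def using fin by (subst Max_less_iff) auto

lemma cell_gauge_le_iff: "cell_gauge W \<rho> \<theta> \<le> t \<longleftrightarrow> 1 / \<rho> \<le> t \<and> (\<forall>w\<in>W. \<theta> \<bullet> w \<le> t)"
  unfolding cell_gauge_def using fin by (subst Max_le_iff) auto

lemma cell_gauge_pos: "0 < cell_gauge W \<rho> \<theta>"
  using cell_gauge_le_iff[of \<theta> 0] \<rho> by (simp add: not_le[symmetric])

lemma cell_gauge_le_1:
  assumes "norm \<theta> = 1"
  shows "cell_gauge W \<rho> \<theta> \<le> 1"
proof -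
  have "\<theta> \<bullet> w \<le> 1" if "w \<in> W" for w
    using norm_cauchy_schwarz[of \<theta> w] assms W that by auto
  then show ?thesis using \<rho> by (simp add: cell_gauge_le_iff)
qed

lemma borel_measurable_cell_gauge: "cell_gauge W \<rho> \<in> borel_measurable borel"
proof (rule borel_measurableI_less)
  fix t
  have "{\<theta>. cell_gauge W \<rho> \<theta> < t} = (\<Inter>w\<in>W. {\<theta>. w \<bullet> \<theta> < t}) \<inter> (if 1 / \<rho> < t then UNIV else {})"
    by (auto simp: cell_gauge_less_iff inner_commute)
  moreover have "open (\<Inter>w\<in>W. {\<theta>. w \<bullet> \<theta> < t})"
    using fin by (intro open_INT ballI open_halfspace_lt)
  ultimately show "{\<theta> \<in> space borel. cell_gauge W \<rho> \<theta> < t} \<in> sets borel"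
    by auto
qed

text \<open>The formula for star-shaped bodies describes the set \<open>?O\<close> with all
  constraints strict, up to the origin. The closed convex body \<open>?K\<close> exceeds its
  interior by a null set only, and \<open>?O\<close> lies between the interior and
  \<open>?K\<close>, so the volumes agree.\<close>

lemma emeasure_cell_cball:
  "emeasure lborel (cell W \<inter> cball 0 \<rho>)
    = (\<integral>\<^sup>+x. ennreal ((1 / cell_gauge W \<rho> (sgn x)) ^ 4) * indicator (ball 0 1 - {0}) x \<partial>lborel)"
proof -
  note [measurable] = borel_measurable_cell_gauge
  let ?K = "cell W \<inter> cball 0 \<rho>"
  let ?O = "{x. norm x < \<rho> \<and> (\<forall>w\<in>W. x \<bullet> w < 1)}"
  let ?S = "{x. x \<noteq> 0 \<and> ennreal (norm x) < ennreal (1 / cell_gauge W \<rho> (sgn x))}"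
  have S: "?S = ?O - {0}"
  proof -
    have "norm x < 1 / cell_gauge W \<rho> (sgn x) \<longleftrightarrow> x \<in> ?O" if "x \<noteq> 0" for x
    proof -
      have "norm x < 1 / cell_gauge W \<rho> (sgn x) \<longleftrightarrow> cell_gauge W \<rho> (sgn x) < 1 / norm x"
        using cell_gauge_pos[of "sgn x"] that by (simp add: field_simps)
      also have "\<dots> \<longleftrightarrow> x \<in> ?O"
        using that \<rho> by (simp add: cell_gauge_less_iff sgn_div_norm field_simps)
      finally show ?thesis .
    qed
    then show ?thesis
      using cell_gauge_pos by (auto simp: ennreal_less_iff)
  qed
  have Oopen: "open ?O"
  proof -
    have "?O = ball 0 \<rho> \<inter> (\<Inter>w\<in>W. {x. w \<bullet> x < 1})" by (auto simp: inner_commute)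
    moreover have "open (\<Inter>w\<in>W. {x. w \<bullet> x < 1})"
      using fin by (intro open_INT ballI open_halfspace_lt)
    ultimately show ?thesis by (simp add: open_Int)
  qed
  have K: "convex ?K" "closed ?K"
    by (auto intro: convex_Int convex_cell closed_Int closed_cell)
  have OK: "?O \<subseteq> ?K" by (auto simp: cell_def)
  \<comment> \<open>An interior point can be pushed slightly outward along its own ray and stay in
    \<open>?K\<close>; every constraint therefore held strictly before the push.\<close>
  have int: "interior ?K \<subseteq> ?O"
  proof
    fix x assume "x \<in> interior ?K"
    then obtain e where e: "e > 0" "ball x e \<subseteq> ?K" unfolding mem_interior by blast
    \<comment> \<open>The relative push \<open>t\<close> moves \<open>x\<close> by at most
      \<open>e / 2\<close>; the added 1 keeps the denominator positive when
      \<open>x = 0\<close>.\<close>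
    define t where "t = e / (2 * (norm x + 1))"
    have t: "t > 0" unfolding t_def using e(1) by (intro divide_pos_pos) (simp_all add: add_nonneg_pos)
    have nx: "norm x + 1 > 0" by (simp add: add_nonneg_pos)
    have "t * norm x \<le> t * (norm x + 1)" using t by simp
    also have "\<dots> = e / 2" using nx by (simp add: t_def field_simps)
    also have "\<dots> < e" using e by simp
    finally have "dist x ((1 + t) *\<^sub>R x) < e" using t by (simp add: dist_norm algebra_simps)
    then have *: "(1 + t) *\<^sub>R x \<in> ?K" using e by auto
    then have "(1 + t) * norm x \<le> \<rho>" using t by simp
    moreover have "norm x < (1 + t) * norm x" if "x \<noteq> 0" using t that by simp
    ultimately have "norm x < \<rho>" using \<rho> by (cases "x = 0", simp, blast intro: less_le_trans)
    moreover have "x \<bullet> w < 1" if "w \<in> W" for w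
    proof (rule ccontr)
      assume "\<not> x \<bullet> w < 1"
      then have "1 \<le> x \<bullet> w" by simp
      then have "1 < (1 + t) * (x \<bullet> w)" using t
        by (metis less_add_same_cancel1 less_le_trans mult.right_neutral mult_left_mono add_pos_pos zero_less_one less_imp_le)
      with * that show False by (auto simp: cell_def)
    qed
    ultimately show "x \<in> ?O" by simp
  qed
  have "emeasure lborel ?K = emeasure lborel (?K - (?K - interior ?K))"
    using K by (intro emeasure_Diff_null_set[symmetric] null_sets_convex_frontier) auto
  also have "\<dots> \<le> emeasure lborel ?O"
    using int Oopen by (intro emeasure_mono) auto
  finally have KO: "emeasure lborel ?K \<le> emeasure lborel ?O" .
  have "emeasure lborel ?K = emeasure lborel ?O"
    using K by (intro antisym[OF KO] emeasure_mono[OF OK]) auto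
  also have "\<dots> = emeasure lborel (?O - {0})"
    using Oopen by (intro emeasure_Diff_null_set[symmetric]) auto
  also have "\<dots> = emeasure lborel ?S" by (simp only: S)
  also have "\<dots> = (\<integral>\<^sup>+x. ennreal (1 / cell_gauge W \<rho> (sgn x)) ^ DIM(real^4) * indicator (ball 0 1 - {0}) x \<partial>lborel)"
    by (rule emeasure_star) measurable
  finally show ?thesis
    using cell_gauge_pos by (simp add: ennreal_power less_imp_le)
qed

text \<open>With N the gauge at \<theta> and \<open>c = arccos N\<close>, the admissible radii lie
  between \<open>{0<..<c}\<close> and \<open>{0<..c}\<close>, and both have mass
  \<open>sec4 c - sec4 0\<close>, which is N^(-4) - 1. The entry \<open>1 / \<rho>\<close> in the
  gauge guarantees that c does not exceed the upper limit
  \<open>arccos (1 / \<rho>)\<close>.\<close>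

lemma emeasure_stieltjes_sec4_section:
  assumes \<theta>: "norm \<theta> = 1"
  shows "emeasure (stieltjes_measure 0 (arccos (1 / \<rho>)) sec4) {r \<in> {0<..arccos (1 / \<rho>)}. \<forall>w\<in>W. \<theta> \<bullet> w < cos r}
    = ennreal ((1 / cell_gauge W \<rho> \<theta>) ^ 4 - 1)"
proof -
  define b where "b = arccos (1 / \<rho>)"
  define N where "N = cell_gauge W \<rho> \<theta>"
  have r1: "0 < 1 / \<rho>" "1 / \<rho> \<le> 1" using \<rho> by auto
  have b: "0 \<le> b" "b < pi / 2" "cos b = 1 / \<rho>"
    using arccos_inverse_bounds by (simp_all add: b_def)
  interpret stieltjes 0 b sec4 using b by (intro stieltjes_sec4)
  have N: "1 / \<rho> \<le> N" "0 < N" "N \<le> 1"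
    using cell_gauge_le_iff[of \<theta> N] cell_gauge_pos cell_gauge_le_1[OF \<theta>] by (auto simp: N_def)
  define c where "c = arccos N"
  have N': "- 1 \<le> N" "- 1 \<le> 1 / \<rho>" using N r1 by linarith+
  have c: "0 \<le> c" "c \<le> b" "cos c = N"
    unfolding c_def b_def using N N'
    by (simp_all only: arccos_lbound arccos_le_arccos cos_arccos)
  let ?E = "{r \<in> {0<..b}. \<forall>w\<in>W. \<theta> \<bullet> w < cos r}"
  have sub1: "{0<..<c} \<subseteq> ?E"
  proof
    fix r assume r: "r \<in> {0<..<c}"
    then have "N < cos r" using c b by (subst c(3)[symmetric]) (intro cos_monotone_0_pi, auto)
    then show "r \<in> ?E" using r c by (auto simp: N_def cell_gauge_less_iff)
  qed
  have sub2: "?E \<subseteq> {0<..c}"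
  proof
    fix r assume r: "r \<in> ?E"
    then have "1 / \<rho> \<le> cos r" using b by (subst b(3)[symmetric]) (intro cos_monotone_0_pi_le, auto)
    then have "N \<le> cos r" using r by (auto simp: N_def cell_gauge_le_iff)
    then have "r \<le> c" using r c b by (metis (no_types, lifting) cos_mono_le_eq greaterThanAtMost_iff
      mem_Collect_eq c(3) less_imp_le order_trans pi_half_le_two pi_ge_two)
    then show "r \<in> {0<..c}" using r by auto
  qed
  have Em: "?E \<in> sets borel"
  proof -
    have "?E = {0<..b} \<inter> (\<Inter>w\<in>W. {r. \<theta> \<bullet> w < cos r})" by auto
    moreover have "open (\<Inter>w\<in>W. {r. \<theta> \<bullet> w < cos r})"
      using fin by (intro open_INT ballI open_Collect_less continuous_intros)
    ultimately show ?thesis by simp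
  qed
  have val: "sec4 (max 0 (min b c)) - sec4 (max 0 (min b 0)) = (1 / N) ^ 4 - 1"
  proof -
    have "max 0 (min b c) = c" "max 0 (min b 0) = 0" using c b by auto
    then show ?thesis using c by (simp add: sec4_def power_one_over)
  qed
  have "emeasure (stieltjes_measure 0 b sec4) ?E = ennreal ((1 / N) ^ 4 - 1)"
  proof (rule antisym)
    have "emeasure (stieltjes_measure 0 b sec4) ?E \<le> emeasure (stieltjes_measure 0 b sec4) {0<..c}"
      using sub2 by (intro emeasure_mono) auto
    then show "emeasure (stieltjes_measure 0 b sec4) ?E \<le> ennreal ((1 / N) ^ 4 - 1)"
      using emeasure_Ioc[OF c(1)] val by simp
    have "emeasure (stieltjes_measure 0 b sec4) {0<..<c} \<le> emeasure (stieltjes_measure 0 b sec4) ?E"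
      using sub1 Em by (intro emeasure_mono) auto
    then show "ennreal ((1 / N) ^ 4 - 1) \<le> emeasure (stieltjes_measure 0 b sec4) ?E"
      using emeasure_Ioo[OF c(1)] val by simp
  qed
  then show ?thesis by (simp add: b_def N_def)
qed

section \<open>Exchanging the integrals over directions and radii\<close>

lemma U_set_eq:
  assumes "0 \<le> r" "r \<le> pi"
  shows "{\<theta> \<in> sphere 0 1. \<forall>w\<in>W. ang \<theta> w > r} = {\<theta> \<in> sphere 0 1. \<forall>w\<in>W. \<theta> \<bullet> w < cos r}"
  using W assms by (auto simp: ang_gt_iff subset_eq)

lemma U_set_sets: "{\<theta> \<in> sphere 0 1. \<forall>w\<in>W. ang \<theta> w > r} \<in> sets borel"
proof -
  have "{\<theta> \<in> sphere 0 1. \<forall>w\<in>W. ang \<theta> w > r} = sphere 0 1 - (\<Union>w\<in>W. cap r w)"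
    by (force simp: cap_def)
  moreover have "(\<Union>w\<in>W. cap r w) \<in> sets borel"
    using fin W by (intro sets.finite_UN cap_sets) auto
  ultimately show ?thesis by simp
qed

lemma emeasure_U:
  assumes "0 \<le> r" "r \<le> pi"
  shows "ennreal (U W r) = 4 * emeasure lborel {x \<in> ball 0 1 - {0}. \<forall>w\<in>W. sgn x \<bullet> w < cos r}"
proof -
  interpret finite_measure "surface_measure :: (real^4) measure" by (rule finite_surface_measure)
  let ?A = "{\<theta> \<in> sphere 0 1. \<forall>w\<in>W. ang \<theta> w > r}"
  have "{x \<in> ball 0 1 - {0}. sgn x \<in> ?A} = {x \<in> ball 0 1 - {0}. \<forall>w\<in>W. sgn x \<bullet> w < cos r}"
    unfolding U_set_eq[OF assms] by (auto simp: norm_sgn)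
  then show ?thesis
    using emeasure_surface_measure[OF U_set_sets Collect_restrict]
    unfolding U_def emeasure_eq_measure[symmetric] by simp
qed

text \<open>Enlarging the radius shrinks the uncovered set, so \<open>U W\<close> is antitone;
  negation brings it under the measurability of monotone functions.\<close>

lemma borel_measurable_U [measurable]: "U W \<in> borel_measurable borel"
proof -
  have "mono (\<lambda>r. - U W r)"
    unfolding mono_def U_def neg_le_iff_le using finite_surface_measure
    by (intro allI impI finite_measure.finite_measure_mono sets_surface_measureI U_set_sets) auto
  then have "(\<lambda>r. - U W r) \<in> borel_measurable borel" by (rule borel_measurable_mono)
  then show ?thesis by simp
qed

text \<open>The set \<open>E\<close> of pairs of a radius and a ball point whose direction is
  uncovered at that radius is measured in both orders. For fixed radius its section has volume U/4,
  which accounts for the factor 4; for fixed point its section has mass N^(-4) - 1, with N the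
  gauge. Staying in \<open>ennreal\<close> postpones all finiteness questions.\<close>

lemma nn_integral_U:
  "4 * emeasure lborel (cell W \<inter> cball 0 \<rho>)
    = ennreal (2 * pi\<^sup>2) + (\<integral>\<^sup>+r. ennreal (U W r) * indicator {0<..arccos (1 / \<rho>)} r
        \<partial>stieltjes_measure 0 (arccos (1 / \<rho>)) sec4)"
proof -
  define b where "b = arccos (1 / \<rho>)"
  define M where "M = stieltjes_measure 0 b sec4"
  have [measurable_cong, simp]: "sets M = sets borel" by (simp add: M_def)
  have b: "0 \<le> b" "b < pi / 2"
    using arccos_inverse_bounds by (simp_all add: b_def)
  interpret st: stieltjes 0 b sec4 using b by (intro stieltjes_sec4)
  interpret M: sigma_finite_measure M unfolding M_def by (rule st.sigma_finite)
  interpret P: pair_sigma_finite M "lborel :: (real^4) measure" ..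
  note [measurable] = borel_measurable_cell_gauge
  let ?B = "ball 0 1 - {0 :: real^4}"
  define E where "E = {(r, x). r \<in> {0<..b} \<and> x \<in> ?B \<and> (\<forall>w\<in>W. sgn x \<bullet> w < cos r)}"
  let ?I = "\<lambda>r x. indicator E (r, x) :: ennreal"
  have E [measurable]: "E \<in> sets (M \<Otimes>\<^sub>M lborel)"
  proof -
    have "Measurable.pred (borel \<Otimes>\<^sub>M borel) (\<lambda>p::real \<times> (real^4). \<forall>w\<in>W. sgn (snd p) \<bullet> w < cos (fst p))"
      by (rule pred_intros_finite(3)[OF fin]) measurable
    note [measurable] = this
    have "{p \<in> space (borel \<Otimes>\<^sub>M borel). 0 < fst p \<and> fst p \<le> b \<and> norm (snd p) < 1 \<and> snd p \<noteq> 0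
        \<and> (\<forall>w\<in>W. sgn (snd p) \<bullet> w < cos (fst p))} \<in> sets (borel \<Otimes>\<^sub>M borel)"
      by measurable
    also have "sets (borel \<Otimes>\<^sub>M borel) = sets (M \<Otimes>\<^sub>M (lborel :: (real^4) measure))"
      by (rule sets_pair_measure_cong) auto
    finally show ?thesis by (simp add: E_def case_prod_unfold space_pair_measure conj_assoc)
  qed
  have "(\<integral>\<^sup>+r. ennreal (U W r) * indicator {0<..b} r \<partial>M) = (\<integral>\<^sup>+r. 4 * (\<integral>\<^sup>+x. ?I r x \<partial>lborel) \<partial>M)"
  proof (rule nn_integral_cong)
    fix r
    show "ennreal (U W r) * indicator {0<..b} r = 4 * (\<integral>\<^sup>+x. ?I r x \<partial>lborel)"
    proof (cases "r \<in> {0<..b}")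
      case True
      have "(\<integral>\<^sup>+x. ?I r x \<partial>lborel) = (\<integral>\<^sup>+x. indicator {x \<in> ?B. \<forall>w\<in>W. sgn x \<bullet> w < cos r} x \<partial>lborel)"
        using True by (intro nn_integral_cong) (auto simp: E_def indicator_def)
      also have "\<dots> = emeasure lborel {x \<in> ?B. \<forall>w\<in>W. sgn x \<bullet> w < cos r}"
      proof (rule nn_integral_indicator)
        have "Measurable.pred borel (\<lambda>x. \<forall>w\<in>W. sgn x \<bullet> w < cos r)"
          by (rule pred_intros_finite(3)[OF fin]) measurable
        note [measurable] = this
        have "{x \<in> space borel. x \<in> ?B \<and> (\<forall>w\<in>W. sgn x \<bullet> w < cos r)} \<in> sets borel"
          unfolding Diff_iff mem_ball_0 singleton_iff by measurable
        then show "{x \<in> ?B. \<forall>w\<in>W. sgn x \<bullet> w < cos r} \<in> sets lborel" by simp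
      qed
      finally show ?thesis using emeasure_U[of r] True b by simp
    qed (auto simp: E_def indicator_def)
  qed
  also have "\<dots> = 4 * (\<integral>\<^sup>+r. (\<integral>\<^sup>+x. ?I r x \<partial>lborel) \<partial>M)"
    by (intro nn_integral_cmult) measurable
  also have "(\<integral>\<^sup>+r. (\<integral>\<^sup>+x. ?I r x \<partial>lborel) \<partial>M) = (\<integral>\<^sup>+x. (\<integral>\<^sup>+r. ?I r x \<partial>M) \<partial>lborel)"
    by (intro P.Fubini'[symmetric]) measurable
  also have "\<dots> = (\<integral>\<^sup>+x. ennreal ((1 / cell_gauge W \<rho> (sgn x)) ^ 4 - 1) * indicator ?B x \<partial>lborel)"
  proof (rule nn_integral_cong)
    fix x
    show "(\<integral>\<^sup>+r. ?I r x \<partial>M) = ennreal ((1 / cell_gauge W \<rho> (sgn x)) ^ 4 - 1) * indicator ?B x"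
    proof (cases "x \<in> ?B")
      case True
      have "(\<integral>\<^sup>+r. ?I r x \<partial>M) = (\<integral>\<^sup>+r. indicator {r \<in> {0<..b}. \<forall>w\<in>W. sgn x \<bullet> w < cos r} r \<partial>M)"
        using True by (intro nn_integral_cong) (auto simp: E_def indicator_def)
      also have "\<dots> = emeasure M {r \<in> {0<..b}. \<forall>w\<in>W. sgn x \<bullet> w < cos r}"
      proof (rule nn_integral_indicator)
        have "Measurable.pred borel (\<lambda>r::real. \<forall>w\<in>W. sgn x \<bullet> w < cos r)"
          by (rule pred_intros_finite(3)[OF fin]) measurable
        note [measurable] = this
        have "{r \<in> space borel. r \<in> {0<..b} \<and> (\<forall>w\<in>W. sgn x \<bullet> w < cos r)} \<in> sets borel"
          by measurable
        then show "{r \<in> {0<..b}. \<forall>w\<in>W. sgn x \<bullet> w < cos r} \<in> sets M" by simp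
      qed
      finally show ?thesis
        using emeasure_stieltjes_sec4_section[of "sgn x"] True by (simp add: M_def b_def norm_sgn)
    qed (auto simp: E_def indicator_def)
  qed
  finally have I: "(\<integral>\<^sup>+r. ennreal (U W r) * indicator {0<..b} r \<partial>M)
    = 4 * (\<integral>\<^sup>+x. ennreal ((1 / cell_gauge W \<rho> (sgn x)) ^ 4 - 1) * indicator ?B x \<partial>lborel)" .
  have B: "(\<integral>\<^sup>+x. indicator ?B x \<partial>lborel) = ennreal (pi\<^sup>2 / 2)"
  proof -
    have "(\<integral>\<^sup>+x. indicator ?B x \<partial>lborel) = emeasure lborel ?B"
      by (rule nn_integral_indicator) simp
    also have "\<dots> = emeasure lborel (ball (0 :: real^4) 1)"
      by (rule emeasure_Diff_null_set) auto
    finally show ?thesis by (simp add: emeasure_ball unit_ball_vol_4)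
  qed
  \<comment> \<open>Split N^(-4) as 1 + (N^(-4) - 1); the second part is nonnegative because the
    gauge is at most 1 on the sphere. The constant part contributes the volume of the unit ball,
    hence the summand 2 pi^2 after multiplication by 4.\<close>
  have "emeasure lborel (cell W \<inter> cball 0 \<rho>)
    = (\<integral>\<^sup>+x. indicator ?B x + ennreal ((1 / cell_gauge W \<rho> (sgn x)) ^ 4 - 1) * indicator ?B x \<partial>lborel)"
    unfolding emeasure_cell_cball
  proof (rule nn_integral_cong)
    fix x
    show "ennreal ((1 / cell_gauge W \<rho> (sgn x)) ^ 4) * indicator ?B x
      = indicator ?B x + ennreal ((1 / cell_gauge W \<rho> (sgn x)) ^ 4 - 1) * indicator ?B x"
    proof (cases "x \<in> ?B")
      case True
      then have "1 \<le> 1 / cell_gauge W \<rho> (sgn x)"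
        using cell_gauge_pos[of "sgn x"] cell_gauge_le_1[of "sgn x"] by (simp add: norm_sgn)
      then have "1 \<le> (1 / cell_gauge W \<rho> (sgn x)) ^ 4" by (rule one_le_power)
      then show ?thesis using True ennreal_plus[of 1 "(1 / cell_gauge W \<rho> (sgn x)) ^ 4 - 1"] by simp
    qed simp
  qed
  also have "\<dots> = ennreal (pi\<^sup>2 / 2)
      + (\<integral>\<^sup>+x. ennreal ((1 / cell_gauge W \<rho> (sgn x)) ^ 4 - 1) * indicator ?B x \<partial>lborel)"
  proof -
    have [measurable]: "?B \<in> sets borel" by simp
    show ?thesis unfolding B[symmetric] by (rule nn_integral_add) measurable
  qed
  finally have "4 * emeasure lborel (cell W \<inter> cball 0 \<rho>) = 4 * ennreal (pi\<^sup>2 / 2)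
      + (\<integral>\<^sup>+r. ennreal (U W r) * indicator {0<..b} r \<partial>M)"
    unfolding I by (simp add: distrib_left)
  also have "4 * ennreal (pi\<^sup>2 / 2) = ennreal (2 * pi\<^sup>2)"
    by (subst ennreal_numeral[symmetric], subst ennreal_mult[symmetric]) auto
  finally show ?thesis by (simp add: M_def b_def)
qed

lemma vol_cell_cball:
  "vol (cell W \<inter> cball 0 \<rho>)
    = 1 / 4 * (2 * pi\<^sup>2 + stieltjes_integral 0 (arccos (1 / \<rho>)) (U W) sec4)"
proof -
  define b where "b = arccos (1 / \<rho>)"
  define M where "M = stieltjes_measure 0 b sec4"
  have b: "0 \<le> b" "b < pi / 2"
    using arccos_inverse_bounds by (simp_all add: b_def)
  have U0: "0 \<le> U W r" for r by (simp add: U_def)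
  let ?I = "\<integral>\<^sup>+r. ennreal (U W r) * indicator {0<..b} r \<partial>M"
  have "stieltjes_integral 0 b (U W) sec4 = (\<integral>r. indicator {0<..b} r *\<^sub>R U W r \<partial>M)"
    by (simp add: stieltjes_integral_eq M_def set_lebesgue_integral_def)
  also have "\<dots> = enn2real (\<integral>\<^sup>+r. ennreal (indicator {0<..b} r *\<^sub>R U W r) \<partial>M)"
    by (rule integral_eq_nn_integral) (simp_all add: M_def U0)
  also have "(\<integral>\<^sup>+r. ennreal (indicator {0<..b} r *\<^sub>R U W r) \<partial>M) = ?I"
    by (intro nn_integral_cong) (auto simp: indicator_def)
  finally have int: "stieltjes_integral 0 b (U W) sec4 = enn2real ?I" .
  have K: "cell W \<inter> cball 0 \<rho> \<in> sets borel" by (simp add: closed_cell borel_closed)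
  have fin: "emeasure lborel (cell W \<inter> cball 0 \<rho>) < \<infinity>"
    by (rule emeasure_bounded_finite) (auto intro: bounded_subset[OF bounded_cball])
  have eq: "4 * emeasure lborel (cell W \<inter> cball 0 \<rho>) = ennreal (2 * pi\<^sup>2) + ?I"
    using nn_integral_U by (simp add: b_def M_def)
  \<comment> \<open>Finiteness comes first, since \<open>enn2real\<close> sends \<open>top\<close>
    to 0 and is additive only on finite values. It follows from the identity, whose left side is the
    volume of a bounded set.\<close>
  have "?I < \<infinity>"
  proof -
    have "4 * emeasure lborel (cell W \<inter> cball 0 \<rho>) < \<infinity>"
      using fin by (simp add: ennreal_mult_less_top)
    then show ?thesis unfolding eq by (simp add: ennreal_add_less_top)
  qed
  then have "4 * measure lborel (cell W \<inter> cball 0 \<rho>) = 2 * pi\<^sup>2 + enn2real ?I"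
    using arg_cong[OF eq, of enn2real] by (simp add: enn2real_mult enn2real_plus measure_def)
  then show ?thesis
    using K int by (simp add: measure_completion b_def)
qed

end

section \<open>Measure of a cap\<close>

text \<open>Exhibits four-space as a product of the axis and a three-dimensional factor, so that a
  sector can be sliced perpendicular to its axis.\<close>

definition pair_vec :: "real \<times> (real^3) \<Rightarrow> real^4" where
  "pair_vec p = vector [fst p, snd p $ 1, snd p $ 2, snd p $ 3]"

lemma pair_vec_nth:
  "pair_vec p $ 1 = fst p" "pair_vec p $ 2 = snd p $ 1" "pair_vec p $ 3 = snd p $ 2" "pair_vec p $ 4 = snd p $ 3"
  by (simp_all add: pair_vec_def vector_def)

lemma prod_4: "prod f (UNIV::4 set) = f 1 * f 2 * f 3 * f 4"
  unfolding UNIV_4 by (simp add: ac_simps)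

lemma prod_3: "prod f (UNIV::3 set) = f 1 * f 2 * f 3"
  unfolding UNIV_3 by (simp add: ac_simps)

lemma continuous_on_pair_vec: "continuous_on S pair_vec"
proof -
  have "continuous_on S (\<lambda>p :: real \<times> (real^3). fst p)" "continuous_on S (\<lambda>p :: real \<times> (real^3). snd p $ j)" for j
    by (intro continuous_intros)+
  then have "continuous_on S (\<lambda>p. pair_vec p $ i)" for i
    using exhaust_4[of i] by (elim disjE) (simp_all only: pair_vec_nth)
  then have "continuous_on S (\<lambda>p. \<chi> i. pair_vec p $ i)" by (rule continuous_on_vec_lambda)
  then show ?thesis by simp
qed

lemma borel_measurable_pair_vec [measurable]: "pair_vec \<in> borel_measurable borel"
  by (rule borel_measurable_continuous_onI) (rule continuous_on_pair_vec)

lemma prod_Basis_vec: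
  "(\<Prod>b\<in>Basis. (x :: real^'n) \<bullet> b) = (\<Prod>i\<in>UNIV. x $ i)"
proof -
  have B: "(Basis :: (real^'n) set) = (\<lambda>i. axis i 1) ` UNIV" by (auto simp: Basis_vec_def)
  show ?thesis unfolding B
    by (subst prod.reindex) (auto simp: inj_on_def axis_eq_axis inner_axis)
qed

text \<open>Lebesgue measure is determined by its values on boxes, and the preimage of a box is an
  interval times a three-dimensional box.\<close>

lemma distr_pair_vec: "distr (lborel \<Otimes>\<^sub>M lborel) borel pair_vec = lborel"
proof (rule lborel_eqI[symmetric])
  fix l u :: "real^4" assume le: "\<And>b. b \<in> Basis \<Longrightarrow> l \<bullet> b \<le> u \<bullet> b"
  have le': "l $ i \<le> u $ i" for i using le[of "axis i 1"] by (simp add: inner_axis)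
  define l' u' :: "real^3" where "l' = vector [l $ 2, l $ 3, l $ 4]" and "u' = vector [u $ 2, u $ 3, u $ 4]"
  have nth: "l' $ 1 = l $ 2" "l' $ 2 = l $ 3" "l' $ 3 = l $ 4" "u' $ 1 = u $ 2" "u' $ 2 = u $ 3" "u' $ 3 = u $ 4"
    by (simp_all add: l'_def u'_def vector_3)
  have vim: "pair_vec -` box l u = {l $ 1<..<u $ 1} \<times> box l' u'"
    by (auto simp: mem_box_cart forall_4 forall_3 pair_vec_nth nth)
  have "emeasure (distr (lborel \<Otimes>\<^sub>M lborel) borel pair_vec) (box l u)
      = emeasure (lborel \<Otimes>\<^sub>M lborel) ({l $ 1<..<u $ 1} \<times> box l' u')"
    by (subst emeasure_distr) (simp_all add: vim space_pair_measure lborel_prod)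
  also have "\<dots> = emeasure lborel {l $ 1<..<u $ 1} * emeasure lborel (box l' u')"
    by (rule lborel.emeasure_pair_measure_Times) auto
  also have "emeasure lborel (box l' u') = ennreal (\<Prod>b\<in>Basis. (u' - l') \<bullet> b)"
  proof (rule emeasure_lborel_box)
    fix b :: "real^3" assume "b \<in> Basis"
    then obtain i where "b = axis i 1" by (auto simp: Basis_vec_def)
    then show "l' \<bullet> b \<le> u' \<bullet> b"
      using exhaust_3[of i] le' by (auto simp: inner_axis nth)
  qed
  also have "emeasure lborel {l $ 1<..<u $ 1} * ennreal (\<Prod>b\<in>Basis. (u' - l') \<bullet> b)
      = ennreal (\<Prod>b\<in>Basis. (u - l) \<bullet> b)"
    using le' by (simp add: prod_Basis_vec prod_3 prod_4 nth ennreal_mult[symmetric] mult.assoc)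
  finally show "emeasure (distr (lborel \<Otimes>\<^sub>M lborel) borel pair_vec) (box l u) = (\<Prod>b\<in>Basis. (u - l) \<bullet> b)" .
qed simp

lemma norm_pair_vec: "norm (pair_vec (t, y)) = sqrt (t\<^sup>2 + (norm y)\<^sup>2)"
  by (simp add: norm_eq_sqrt_inner power2_norm_eq_inner inner_vec_def sum_4 sum_3 pair_vec_nth power2_eq_square)

text \<open>The integrand is the cubed radius of the slice at height t of a solid sector of angle r
  in the unit ball: the cone bounds the slice below height cos r, the sphere above it. The constant
  4 pi / 3 of the ball volume is left out here.\<close>

lemma has_integral_sector_sections:
  assumes r: "0 \<le> r" "r < pi / 2"
  shows "((\<lambda>t. min (t * tan r) (sqrt (1 - t\<^sup>2)) ^ 3) has_integral 3 / 8 * (r - sin r * cos r)) {0..1}"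
proof -
  define c where "c = cos r"
  have c: "0 < c" "c \<le> 1" using r by (auto simp: c_def intro: cos_gt_zero_pi)
  have s: "0 \<le> sin r" using r by (intro sin_ge_zero) auto
  have sc: "(sin r)\<^sup>2 = 1 - c\<^sup>2" by (simp add: c_def sin_squared_eq)
  let ?m = "\<lambda>t. min (t * tan r) (sqrt (1 - t\<^sup>2)) ^ 3"
  \<comment> \<open>An antiderivative of (1 - t^2)^(3/2); its derivative is brought over the common
    denominator 8 q, where the numerator becomes 8 q^4 with q = sqrt (1 - t^2).\<close>
  let ?G = "\<lambda>t. t / 8 * (5 - 2 * t\<^sup>2) * sqrt (1 - t\<^sup>2) + 3 / 8 * arcsin t"
  have tan: "0 \<le> tan r" "c * tan r = sin r" using s c by (auto simp: tan_def c_def)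
  have sin_c: "sqrt (1 - c\<^sup>2) = sin r" unfolding sc[symmetric] using s by simp
  have m1: "?m t = tan r ^ 3 * t ^ 3" if "t \<in> {0..c}" for t
  proof -
    have "t * tan r \<le> c * tan r" using that tan by (intro mult_right_mono) auto
    also have "\<dots> = sqrt (1 - c\<^sup>2)" by (simp add: tan sin_c)
    also have "\<dots> \<le> sqrt (1 - t\<^sup>2)" using that c by (simp add: power_mono)
    finally show ?thesis by (simp add: min_absorb1 power_mult_distrib)
  qed
  have m2: "?m t = sqrt (1 - t\<^sup>2) ^ 3" if "t \<in> {c..1}" for t
  proof -
    have "sqrt (1 - t\<^sup>2) \<le> sqrt (1 - c\<^sup>2)" using that c by (simp add: power_mono)
    also have "\<dots> = c * tan r" by (simp add: tan sin_c)
    also have "\<dots> \<le> t * tan r" using that tan by (intro mult_right_mono) auto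
    finally show ?thesis by (simp add: min_absorb2)
  qed
  have "((\<lambda>t. tan r ^ 3 * t ^ 3) has_integral (tan r ^ 3 * c ^ 4 / 4 - tan r ^ 3 * 0 ^ 4 / 4)) {0..c}"
    using c by (intro fundamental_theorem_of_calculus)
      (auto intro!: derivative_eq_intros simp: has_real_derivative_iff_has_vector_derivative[symmetric])
  then have I1: "(?m has_integral (tan r ^ 3 * c ^ 4 / 4)) {0..c}"
    by (subst has_integral_cong[OF m1]) simp_all
  have "((\<lambda>t. sqrt (1 - t\<^sup>2) ^ 3) has_integral (?G 1 - ?G c)) {c..1}"
  \<comment> \<open>Only interior derivatives are used, because the square root and
    \<open>arcsin\<close> lose differentiability at the end \<open>t = 1\<close>.\<close>
  proof (rule fundamental_theorem_of_calculus_interior)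
    show "continuous_on {c..1} ?G"
      using c by (intro continuous_intros) auto
    fix t assume t: "t \<in> {c<..<1}"
    then have t1: "0 < 1 - t\<^sup>2" using c by (simp add: power_less_one_iff abs_square_less_1)
    define q where "q = sqrt (1 - t\<^sup>2)"
    have q: "q > 0" "q\<^sup>2 = 1 - t\<^sup>2" using t1 by (simp_all add: q_def)
    have "(?G has_real_derivative ((5 - 6 * t\<^sup>2) / 8 * q + t / 8 * (5 - 2 * t\<^sup>2) * (- t / q) + 3 / 8 * (1 / q))) (at t)"
    proof -
      have dq: "((\<lambda>t. sqrt (1 - t\<^sup>2)) has_real_derivative - t / q) (at t)"
        using t1 by (auto intro!: derivative_eq_intros simp: q_def divide_simps)
      have da: "(arcsin has_real_derivative 1 / q) (at t)"
        using DERIV_arcsin[of t] t c by (simp add: q_def inverse_eq_divide)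
      have dp: "((\<lambda>t. t / 8 * (5 - 2 * t\<^sup>2)) has_real_derivative (5 - 6 * t\<^sup>2) / 8) (at t)"
        by (auto intro!: derivative_eq_intros simp: power2_eq_square)
      show ?thesis
        by (rule DERIV_cong[OF DERIV_add[OF DERIV_mult[OF dp dq] DERIV_cmult[OF da, of "3/8"]]])
          (simp only: q_def[symmetric] mult.commute[of "- t / q"])
    qed
    also have "(5 - 6 * t\<^sup>2) / 8 * q + t / 8 * (5 - 2 * t\<^sup>2) * (- t / q) + 3 / 8 * (1 / q)
        = ((5 - 6 * t\<^sup>2) * q\<^sup>2 - t\<^sup>2 * (5 - 2 * t\<^sup>2) + 3) / (8 * q)"
      using q by (simp add: field_simps power2_eq_square)
    also have "(5 - 6 * t\<^sup>2) * q\<^sup>2 - t\<^sup>2 * (5 - 2 * t\<^sup>2) + 3 = 8 * (q\<^sup>2)\<^sup>2"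
      unfolding q(2) by (simp add: power2_eq_square algebra_simps)
    also have "8 * (q\<^sup>2)\<^sup>2 / (8 * q) = q ^ 3"
      using q by (simp add: field_simps eval_nat_numeral)
    finally show "(?G has_vector_derivative sqrt (1 - t\<^sup>2) ^ 3) (at t)"
      by (simp add: has_real_derivative_iff_has_vector_derivative[symmetric] q_def)
  qed (use c in auto)
  then have I2: "(?m has_integral (?G 1 - ?G c)) {c..1}"
    by (subst has_integral_cong[OF m2]) simp_all
  have "(?m has_integral (tan r ^ 3 * c ^ 4 / 4 + (?G 1 - ?G c))) {0..1}"
    using c by (intro has_integral_combine[OF _ _ I1 I2]) auto
  also have "tan r ^ 3 * c ^ 4 / 4 + (?G 1 - ?G c) = 3 / 8 * (r - sin r * cos r)"
  proof -
    have "arcsin c = arcsin (sin (pi / 2 - r))" by (simp add: c_def sin_diff)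
    also have "\<dots> = pi / 2 - r" using r by (intro arcsin_sin) auto
    finally have ac: "arcsin c = pi / 2 - r" .
    have "tan r ^ 3 * c ^ 4 = (c * tan r) ^ 3 * c" by (simp add: power_mult_distrib eval_nat_numeral)
    also have "\<dots> = (sin r)\<^sup>2 * sin r * c" unfolding tan by (simp add: eval_nat_numeral)
    finally have tc: "tan r ^ 3 * c ^ 4 = (1 - c\<^sup>2) * sin r * c" unfolding sc .
    show ?thesis
      unfolding tc ac sin_c by (simp add: c_def[symmetric] field_simps power2_eq_square)
  qed
  finally show ?thesis .
qed

text \<open>Rotation invariance puts the centre on the first axis, and the sector over the cap is
  integrated slice by slice. The factors 4 from the cone measure, 4 pi / 3 from the balls and 3/8
  from the section integral combine to 2 pi (r - sin r cos r), which is \<open>C r\<close> by the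
  double-angle formula.\<close>

lemma sigma3_cap:
  assumes w: "norm w = 1" and r: "0 \<le> r" "r < pi / 2"
  shows "sigma3 (cap r w) = C r"
proof -
  define e :: "real^4" where "e = axis 1 1"
  have e: "norm e = 1" by (simp add: e_def)
  have inner_e: "pair_vec p \<bullet> e = fst p" for p by (simp add: e_def inner_axis pair_vec_nth)
  have c: "0 < cos r" using r by (intro cos_gt_zero_pi) auto
  have s: "0 \<le> sin r" using r by (intro sin_ge_zero) auto
  have tan: "0 \<le> tan r" "cos r * tan r = sin r" using s c by (auto simp: tan_def)
  \<comment> \<open>One cap is written as a triple intersection with itself so that the invariance
    result for triples applies.\<close>
  have "sigma3 (cap r w \<inter> cap r w \<inter> cap r w) = sigma3 (cap r e \<inter> cap r e \<inter> cap r e)"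
    using w e by (intro sigma3_three_caps_eq) (auto simp: ang_def norm_eq_1)
  then have "sigma3 (cap r w) = sigma3 (cap r e)" by simp
  also have "\<dots> = 4 * measure lborel {x \<in> ball 0 1 - {0}. sgn x \<in> cap r e}" (is "_ = 4 * measure _ ?D")
    using measure_surface_measure[OF cap_sets[OF e] cap_subset_sphere] by simp
  finally have 1: "sigma3 (cap r w) = 4 * measure lborel ?D" .
  have D: "?D \<in> sets borel" by (intro cone_section_sets cap_sets e)
  let ?m = "\<lambda>t. min (t * tan r) (sqrt (1 - t\<^sup>2))"
  let ?P = "pair_vec -` ?D"
  have P: "?P \<in> sets (lborel \<Otimes>\<^sub>M lborel)"
    unfolding lborel_prod sets_lborel by (rule measurable_sets_borel[OF borel_measurable_pair_vec D])
  \<comment> \<open>With n the norm of the point, being within angle r of the axis means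
    \<open>cos r * n\<close> is at most t. Positivity of \<open>cos r\<close> forces
    \<open>0 < t\<close> and allows squaring in both directions, which gives the cone condition in
    terms of \<open>tan r\<close>.\<close>
  have Pmem: "(t, y) \<in> ?P \<longleftrightarrow> 0 < t \<and> norm y \<le> t * tan r \<and> t\<^sup>2 + (norm y)\<^sup>2 < 1" for t y
  proof -
    define n where "n = norm (pair_vec (t, y))"
    have n2: "n\<^sup>2 = t\<^sup>2 + (norm y)\<^sup>2" by (simp add: n_def norm_pair_vec)
    have n0: "0 \<le> n" by (simp add: n_def)
    have n1: "n < 1 \<longleftrightarrow> t\<^sup>2 + (norm y)\<^sup>2 < 1" using n0 by (simp add: n2[symmetric] abs_square_less_1)
    have "(t, y) \<in> ?P \<longleftrightarrow> n < 1 \<and> n \<noteq> 0 \<and> cos r \<le> t / n"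
    proof -
      have "sgn x \<in> cap r e \<longleftrightarrow> cos r \<le> x \<bullet> e / norm x" if "x \<noteq> 0" for x
      proof -
        have "sgn x \<in> cap r e \<longleftrightarrow> \<not> r < ang (sgn x) e"
          using that by (auto simp: cap_def norm_sgn)
        also have "\<dots> \<longleftrightarrow> cos r \<le> sgn x \<bullet> e"
          using ang_gt_iff[of "sgn x" e r] that e r by (simp add: norm_sgn not_less)
        also have "sgn x \<bullet> e = x \<bullet> e / norm x"
          by (simp add: sgn_div_norm inverse_eq_divide)
        finally show ?thesis .
      qed
      then show ?thesis
        unfolding n_def vimage_def using inner_e[of "(t, y)"] by auto
    qed
    also have "n \<noteq> 0 \<and> cos r \<le> t / n \<longleftrightarrow> 0 < t \<and> norm y \<le> t * tan r"
    proof
      assume *: "n \<noteq> 0 \<and> cos r \<le> t / n"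
      then have n: "0 < n" using n0 by simp
      then have ct: "cos r * n \<le> t" using * by (simp add: field_simps)
      moreover have "0 < cos r * n" using c n by simp
      ultimately have t: "0 < t" by linarith
      have "(cos r)\<^sup>2 * n\<^sup>2 \<le> t\<^sup>2"
        using power_mono[OF ct, of 2] c n by (simp add: power_mult_distrib)
      then have "(cos r)\<^sup>2 * (norm y)\<^sup>2 \<le> (1 - (cos r)\<^sup>2) * t\<^sup>2"
        unfolding n2 by (simp add: algebra_simps)
      also have "1 - (cos r)\<^sup>2 = (cos r * tan r)\<^sup>2" unfolding tan by (simp add: sin_squared_eq)
      finally have "(cos r * norm y)\<^sup>2 \<le> (cos r * (t * tan r))\<^sup>2"
        by (simp add: power_mult_distrib mult_ac)
      then have "cos r * norm y \<le> cos r * (t * tan r)"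
        by (rule power2_le_imp_le) (use c t tan in simp)
      then show "0 < t \<and> norm y \<le> t * tan r" using t c by simp
    next
      assume *: "0 < t \<and> norm y \<le> t * tan r"
      then have n: "n \<noteq> 0" using n2 by (metis add_pos_nonneg less_irrefl power_zero_numeral zero_le_power2 zero_less_power)
      have "(cos r * norm y)\<^sup>2 \<le> (cos r * (t * tan r))\<^sup>2"
        using * c by (intro power_mono mult_left_mono) auto
      also have "\<dots> = (1 - (cos r)\<^sup>2) * t\<^sup>2"
        using tan(2) by (simp add: sin_squared_eq[symmetric] power_mult_distrib[symmetric] mult_ac)
      finally have "(cos r * n)\<^sup>2 \<le> t\<^sup>2"
        by (simp add: power_mult_distrib n2 algebra_simps)
      then have "cos r * n \<le> t" by (rule power2_le_imp_le) (use * in simp)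
      then show "n \<noteq> 0 \<and> cos r \<le> t / n" using n n0 by (simp add: field_simps)
    qed
    finally show ?thesis using n1 by blast
  qed
  \<comment> \<open>The ball constraint is strict and the cone constraint is not, so the slice is
    neither open nor closed in general; it is sandwiched between the open and the closed ball of the
    same radius, which have equal volume.\<close>
  have sec: "emeasure lborel (Pair t -` ?P) = ennreal (4 / 3 * pi * ?m t ^ 3) * indicator {0..1} t" for t
  proof (cases "0 < t \<and> t < 1")
    case True
    define m where "m = ?m t"
    have t2: "0 < 1 - t\<^sup>2" using True by (simp add: abs_square_less_1)
    then have m0: "0 \<le> m" using True tan by (simp add: m_def)
    have lt: "t\<^sup>2 + (norm y)\<^sup>2 < 1 \<longleftrightarrow> norm y < sqrt (1 - t\<^sup>2)" for y :: "real^3"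
    proof -
      have "norm y < sqrt (1 - t\<^sup>2) \<longleftrightarrow> sqrt ((norm y)\<^sup>2) < sqrt (1 - t\<^sup>2)" by simp
      then show ?thesis unfolding real_sqrt_less_iff by auto
    qed
    have "y \<in> Pair t -` ?P \<longleftrightarrow> norm y \<le> t * tan r \<and> norm y < sqrt (1 - t\<^sup>2)" for y
      unfolding vimage_eq[of _ "Pair t"] Pmem lt using True by simp
    then have sub: "ball 0 m \<subseteq> Pair t -` ?P" "Pair t -` ?P \<subseteq> cball 0 m"
      unfolding subset_eq m_def by auto
    have "emeasure lborel (Pair t -` ?P) = ennreal (4 / 3 * pi * m ^ 3)"
    proof (rule antisym)
      show "emeasure lborel (Pair t -` ?P) \<le> ennreal (4 / 3 * pi * m ^ 3)"
        using emeasure_mono[OF sub(2), of lborel] m0 by (simp add: emeasure_cball unit_ball_vol_3)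
      show "ennreal (4 / 3 * pi * m ^ 3) \<le> emeasure lborel (Pair t -` ?P)"
        using emeasure_mono[OF sub(1), of lborel] m0 sets_Pair1[OF P, of t]
        by (simp add: emeasure_ball unit_ball_vol_3)
    qed
    then show ?thesis using True by (simp add: m_def)
  next
    case False
    have empty: "Pair t -` ?P = {}"
    proof (rule ccontr)
      assume "Pair t -` ?P \<noteq> {}"
      then obtain y where "(t, y) \<in> ?P" by blast
      then have "0 < t" "t\<^sup>2 + (norm y)\<^sup>2 < 1" unfolding Pmem by auto
      then have "t\<^sup>2 < 1" by (smt (verit) zero_le_power2)
      then show False using False \<open>0 < t\<close> by (simp add: abs_square_less_1)
    qed
    \<comment> \<open>At heights 0 and 1 the slice is empty, and the formula still agrees because
      its radius degenerates to 0.\<close>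
    have "?m t = 0" if "t \<in> {0..1}"
    proof -
      from that False have "t = 0 \<or> t = 1" by auto
      with tan show ?thesis by auto
    qed
    then show ?thesis unfolding empty by (auto simp: indicator_def)
  qed
  have "emeasure lborel ?D = emeasure (distr (lborel \<Otimes>\<^sub>M lborel) borel pair_vec) ?D"
    by (simp add: distr_pair_vec)
  also have "\<dots> = emeasure (lborel \<Otimes>\<^sub>M lborel) ?P"
    using D by (subst emeasure_distr) (simp_all add: lborel_prod)
  also have "\<dots> = (\<integral>\<^sup>+t. emeasure lborel (Pair t -` ?P) \<partial>lborel)"
    by (rule lborel.emeasure_pair_measure_alt[OF P])
  also have "\<dots> = (\<integral>\<^sup>+t. ennreal (4 / 3 * pi * ?m t ^ 3) * indicator {0..1} t \<partial>lborel)"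
    unfolding sec ..
  also have "\<dots> = ennreal (4 / 3 * pi * (3 / 8 * (r - sin r * cos r)))"
  proof (rule nn_integral_has_integral_lebesgue')
    show "((\<lambda>t. 4 / 3 * pi * ?m t ^ 3) has_integral 4 / 3 * pi * (3 / 8 * (r - sin r * cos r))) {0..1}"
      by (intro has_integral_mult_right has_integral_sector_sections r)
    show "0 \<le> 4 / 3 * pi * ?m t ^ 3" if "t \<in> {0..1}" for t
      using that tan by (auto simp: abs_square_le_1)
  qed
  also have "4 / 3 * pi * (3 / 8 * (r - sin r * cos r)) = pi / 2 * (r - sin r * cos r)" by simp
  finally have E: "emeasure lborel ?D = ennreal (pi / 2 * (r - sin r * cos r))" .
  have "0 \<le> 3 / 8 * (r - sin r * cos r)"
    by (rule has_integral_nonneg[OF has_integral_sector_sections[OF r]])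
      (use tan in \<open>auto simp: abs_square_le_1\<close>)
  then have "measure lborel ?D = pi / 2 * (r - sin r * cos r)"
    unfolding measure_def E by simp
  then show ?thesis unfolding 1 C_def sin_double by (simp add: algebra_simps)
qed

section \<open>The numerical value of the constant\<close>

text \<open>The series alternates with monotone terms tending to 0, so partial sums with an even
  number of terms lie below the limit and those with an odd number above it.\<close>

lemma arctan_partial_sums:
  fixes x :: real
  assumes "0 < x" "x \<le> 1"
  shows "(\<Sum>k<2 * n. (-1) ^ k * (1 / real (k * 2 + 1) * x ^ (k * 2 + 1))) \<le> arctan x"
    and "arctan x \<le> (\<Sum>k<2 * n + 1. (-1) ^ k * (1 / real (k * 2 + 1) * x ^ (k * 2 + 1)))"
proof -
  have x: "\<bar>x\<bar> \<le> 1" using assms by simp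
  note L = summable_Leibniz(2)[OF zeroseq_arctan_series[OF x] monoseq_arctan_series[OF x]]
  have "0 < 1 / real (0 * 2 + 1) * x ^ (0 * 2 + 1)" using assms by simp
  with L have "(\<Sum>k. (-1) ^ k * (1 / real (k * 2 + 1) * x ^ (k * 2 + 1))) \<in>
    {\<Sum>k<2 * n. (-1) ^ k * (1 / real (k * 2 + 1) * x ^ (k * 2 + 1))..
      \<Sum>k<2 * n + 1. (-1) ^ k * (1 / real (k * 2 + 1) * x ^ (k * 2 + 1))}"
    by blast
  then show "(\<Sum>k<2 * n. (-1) ^ k * (1 / real (k * 2 + 1) * x ^ (k * 2 + 1))) \<le> arctan x"
    "arctan x \<le> (\<Sum>k<2 * n + 1. (-1) ^ k * (1 / real (k * 2 + 1) * x ^ (k * 2 + 1)))"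
    unfolding arctan_series[OF x] by simp_all
qed

lemma sqrt_15_bounds: "3.8729833462 \<le> sqrt 15" "sqrt 15 \<le> 3.8729833463"
  by (rule real_le_rsqrt, simp add: power2_eq_square, rule real_le_lsqrt) (simp_all add: power2_eq_square)

text \<open>An angle with sine 1/4 has tangent 1 / sqrt 15, so each term of the arctangent series is
  rational up to one common factor sqrt 15 / 15. Eight terms bound it below and nine above; the
  rational factors differ by 1 / (17 * 15^8), about 2.3e-11.\<close>

lemma arcsin_quarter_bounds: "0.25268025513 \<le> arcsin (1/4)" "arcsin (1/4) \<le> 0.25268025516"
proof -
  define x where "x = 1 / sqrt 15"
  have x: "0 < x" "x \<le> 1" "x\<^sup>2 = 1 / 15" "x = sqrt 15 / 15"
    by (simp_all add: x_def power_divide real_div_sqrt field_simps)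
  have pw: "x ^ (k * 2 + 1) = (1 / 15) ^ k * x" for k
    by (simp only: power_add power_one_right mult.commute[of k] power_mult x(3))
  have "sqrt (1 - (1 / 4)\<^sup>2) = sqrt 15 / 4"
    by (rule real_sqrt_unique) (simp_all add: power_divide)
  then have a: "arcsin (1/4) = arctan x"
    by (subst arcsin_arctan) (simp_all only: x_def, simp_all)
  have "x * (\<Sum>k<8. (-1) ^ k / real (k * 2 + 1) * (1 / 15) ^ k) \<le> arcsin (1/4)"
    using arctan_partial_sums(1)[OF x(1,2), of 4] unfolding a pw by (simp add: sum_distrib_left mult_ac)
  moreover have "(\<Sum>k<8. (-1) ^ k / real (k * 2 + 1) * (1 / 15) ^ k) \<ge> (0.97862642005 :: real)"
    by (simp add: eval_nat_numeral)
  moreover have "arcsin (1/4) \<le> x * (\<Sum>k<9. (-1) ^ k / real (k * 2 + 1) * (1 / 15) ^ k)"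
    using arctan_partial_sums(2)[OF x(1,2), of 4] unfolding a pw by (simp add: sum_distrib_left mult_ac)
  moreover have "(\<Sum>k<9. (-1) ^ k / real (k * 2 + 1) * (1 / 15) ^ k) \<le> (0.97862642010 :: real)"
    by (simp add: eval_nat_numeral)
  ultimately have "x * 0.97862642005 \<le> arcsin (1/4)" "arcsin (1/4) \<le> x * 0.97862642010"
    using x(1) by (meson mult_left_mono order_trans less_imp_le)+
  then show "0.25268025513 \<le> arcsin (1/4)" "arcsin (1/4) \<le> 0.25268025516"
    using sqrt_15_bounds unfolding x(4) by simp_all
qed

text \<open>cos (2 r4) = 1 - 2 * 3/8 = 1/4, so \<open>arcsin (1/4)\<close> is the only inverse
  trigonometric value entering the closed form of \<open>A4\<close>.\<close>

lemma two_r4: "2 * r4 = pi / 2 - arcsin (1/4)"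
proof -
  have "sin (pi / 2 - 2 * r4) = 1 / 4"
    unfolding sin_diff by (simp add: cos_double_sin sin_r4)
  then have "arcsin (1/4) = arcsin (sin (pi / 2 - 2 * r4))" by (simp only:)
  also have "\<dots> = pi / 2 - 2 * r4"
    using r4_bounds by (intro arcsin_sin) auto
  finally show ?thesis by simp
qed

lemma sec4_r4: "sec4 r4 = 64 / 25"
proof -
  have "cos r4 ^ 4 = ((cos r4)\<^sup>2)\<^sup>2" by simp
  also have "\<dots> = 25 / 64" by (simp add: cos_r4 power2_eq_square)
  finally show ?thesis unfolding sec4_def by (simp only:) simp
qed

lemma tan_r4: "tan r4 ^ 3 = 3 / 25 * sqrt 15"
proof -
  have t: "tan r4 = sqrt 15 / 5"
  proof -
    have "tan r4 = sqrt (3/8) / sqrt (5/8)" by (simp only: tan_def sin_r4 cos_r4)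
    also have "\<dots> = sqrt (15/25)" by (simp only: real_sqrt_divide[symmetric]) simp
    also have "\<dots> = sqrt 15 / 5" by (simp only: real_sqrt_divide) simp
    finally show ?thesis .
  qed
  show ?thesis unfolding t by (simp add: power3_eq_cube)
qed

lemma C_r4: "C r4 = pi * (pi / 2 - arcsin (1/4) - sqrt 15 / 4)"
proof -
  have "sqrt (3/8) * sqrt (5/8) = sqrt 15 / 8"
    by (simp add: real_sqrt_mult[symmetric] real_sqrt_divide)
  then have "sin (2 * r4) = sqrt 15 / 4" by (simp add: sin_double sin_r4 cos_r4)
  then show ?thesis by (simp add: C_def two_r4)
qed

lemma A4_eq: "A4 = pi / 100 * (1472 * arcsin (1/4) + 460 * sqrt 15 - 608 * pi)"
proof -
  have "stieltjes_integral 0 r4 (\<lambda>r. 2 * pi\<^sup>2 - 23 * C r) sec4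
      = 2 * pi\<^sup>2 * (sec4 r4 - 1) - 23 * (C r4 * sec4 r4 - 4 * pi / 3 * tan r4 ^ 3)"
    using r4_bounds by (intro stieltjes_integral_C) auto
  then show ?thesis
    unfolding A4_def sec4_r4 tan_r4 C_r4 by (simp add: field_simps power2_eq_square)
qed

text \<open>The bounds express that the decimal expansion starts 7.647558. The closed form has
  coefficients up to about 10^3 and large terms that partly cancel, so the inputs carry more digits
  than the result.\<close>

lemma A4_bounds: "7.647558 \<le> A4" "A4 < 7.647559"
proof -
  let ?X = "1472 * arcsin (1/4) + 460 * sqrt 15 - 608 * pi"
  have X: "243.42934 \<le> ?X" "?X \<le> 243.42935"
    using arcsin_quarter_bounds sqrt_15_bounds pi_approx by simp_all
  have "7.647558 \<le> 3.141592653588 / 100 * (243.42934 :: real)" by simp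
  also have "\<dots> \<le> pi / 100 * ?X"
    using X(1) pi_approx(1) by (intro mult_mono) simp_all
  finally show "7.647558 \<le> A4" unfolding A4_eq .
  have "pi / 100 * ?X \<le> 3.1415926535899 / 100 * 243.42935"
    using X pi_approx(2) by (intro mult_mono) simp_all
  also have "\<dots> < (7.647559 :: real)" by simp
  finally show "A4 < 7.647559" unfolding A4_eq .
qed

section \<open>The main theorem\<close>

lemma norm_contact_configuration: "contact_configuration W \<Longrightarrow> w \<in> W \<Longrightarrow> norm w = 1"
  by (auto simp: contact_configuration_def)

lemma U_inclusion_exclusion:
  fixes w :: "nat \<Rightarrow> real ^ 4"
  assumes inj: "inj_on w {1..m}" and W: "contact_configuration (w ` {1..m})" and r: "0 \<le> r" "r < r4"
  shows "U (w ` {1..m}) r = 2 * pi\<^sup>2 - real m * C r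
    + (\<Sum>i\<in>{1..m}. \<Sum>j\<in>{i<..m}. Lam r (ang (w i) (w j)))
    - (\<Sum>i\<in>{1..m}. \<Sum>j\<in>{i<..m}. \<Sum>k\<in>{j<..m}. Lam3 r (ang (w i) (w j)) (ang (w i) (w k)) (ang (w j) (w k)))"
proof -
  have n: "norm (w i) = 1" if "i \<in> {1..m}" for i
    using W that by (intro norm_contact_configuration) auto
  have ne: "w i \<noteq> w j" if "i \<in> {1..m}" "j \<in> {1..m}" "i < j" for i j
    using inj that by (auto dest: inj_onD)
  have r2: "r < pi / 2" using r r4_bounds by simp
  have "U (w ` {1..m}) r = sigma3 (space surface_measure - (\<Union>i\<in>{1..m}. cap r (w i)))"
    unfolding U_def space_surface_measure by (rule arg_cong[where f = sigma3]) (force simp: cap_def)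
  also have "\<dots> = sigma3 (space surface_measure) - (\<Sum>i\<in>{1..m}. sigma3 (cap r (w i)))
    + (\<Sum>i\<in>{1..m}. \<Sum>j\<in>{i<..m}. sigma3 (cap r (w i) \<inter> cap r (w j)))
    - (\<Sum>i\<in>{1..m}. \<Sum>j\<in>{i<..m}. \<Sum>k\<in>{j<..m}. sigma3 (cap r (w i) \<inter> cap r (w j) \<inter> cap r (w k)))"
  proof (rule finite_measure.measure_compl_no_quadruples[OF finite_surface_measure])
    show "cap r (w i) \<in> sets surface_measure" if "i \<in> {1..m}" for i
      using n[OF that] by (intro sets_surface_measureI cap_sets cap_subset_sphere)
    show "cap r (w i) \<inter> cap r (w j) \<inter> cap r (w k) \<inter> cap r (w l) = {}"
      if "1 \<le> i" "i < j" "j < k" "k < l" "l \<le> m" for i j k l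
      using that by (intro four_caps_disjoint[OF W] ne r) auto
  qed
  also have "(\<Sum>i\<in>{1..m}. sigma3 (cap r (w i))) = real m * C r"
    using n r(1) r2 by (simp add: sigma3_cap)
  also have "(\<Sum>i\<in>{1..m}. \<Sum>j\<in>{i<..m}. sigma3 (cap r (w i) \<inter> cap r (w j)))
      = (\<Sum>i\<in>{1..m}. \<Sum>j\<in>{i<..m}. Lam r (ang (w i) (w j)))"
    by (intro sum.cong refl Lam_eq[symmetric] n) auto
  also have "(\<Sum>i\<in>{1..m}. \<Sum>j\<in>{i<..m}. \<Sum>k\<in>{j<..m}. sigma3 (cap r (w i) \<inter> cap r (w j) \<inter> cap r (w k)))
      = (\<Sum>i\<in>{1..m}. \<Sum>j\<in>{i<..m}. \<Sum>k\<in>{j<..m}. Lam3 r (ang (w i) (w j)) (ang (w i) (w k)) (ang (w j) (w k)))"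
    by (intro sum.cong refl Lam3_eq[symmetric] n) auto
  finally show ?thesis
    by (simp add: space_surface_measure surface_measure_total)
qed

lemma Lam3_eq_0:
  fixes w :: "nat \<Rightarrow> real ^ 4"
  assumes inj: "inj_on w {1..m}" and W: "contact_configuration (w ` {1..m})" and r: "0 \<le> r" "r < r_star"
    and ijk: "1 \<le> i" "i < j" "j < k" "k \<le> m"
  shows "Lam3 r (ang (w i) (w j)) (ang (w i) (w k)) (ang (w j) (w k)) = 0"
proof -
  have n: "norm (w i) = 1" if "i \<in> {1..m}" for i
    using W that by (intro norm_contact_configuration) auto
  have ne: "w i \<noteq> w j" if "i \<in> {1..m}" "j \<in> {1..m}" "i < j" for i j
    using inj that by (auto dest: inj_onD)
  have "cap r (w i) \<inter> cap r (w j) \<inter> cap r (w k) = {}"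
    using ijk by (intro three_caps_disjoint[OF W] ne r) auto
  then show ?thesis using ijk n by (subst Lam3_eq) auto
qed

section \<open>Termwise integration of the inclusion-exclusion formula\<close>

lemma cap_mono: "r \<le> s \<Longrightarrow> cap r w \<subseteq> cap s w"
  by (auto simp: cap_def)

lemma sigma3_le: "sigma3 A \<le> 2 * pi\<^sup>2"
  using finite_measure.bounded_measure[OF finite_surface_measure, of A]
  by (simp add: space_surface_measure surface_measure_total)

text \<open>For fixed centres the intersection of the caps grows with the radius, so its measure is
  monotone in r and hence Borel.\<close>

lemma borel_measurable_Lam:
  fixes u v :: "real ^ 4"
  assumes "norm u = 1" "norm v = 1"
  shows "(\<lambda>r. Lam r (ang u v)) \<in> borel_measurable borel"
proof -
  have "mono (\<lambda>r. sigma3 (cap r u \<inter> cap r v))"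
    unfolding mono_def using assms
    by (intro allI impI finite_measure.finite_measure_mono[OF finite_surface_measure] Int_mono cap_mono
        sets_surface_measureI sets.Int cap_sets le_infI1 cap_subset_sphere) auto
  then show ?thesis unfolding Lam_eq[OF assms] by (rule borel_measurable_mono)
qed

lemma borel_measurable_Lam3:
  fixes u v w :: "real ^ 4"
  assumes "norm u = 1" "norm v = 1" "norm w = 1"
  shows "(\<lambda>r. Lam3 r (ang u v) (ang u w) (ang v w)) \<in> borel_measurable borel"
proof -
  have "mono (\<lambda>r. sigma3 (cap r u \<inter> cap r v \<inter> cap r w))"
    unfolding mono_def using assms
    by (intro allI impI finite_measure.finite_measure_mono[OF finite_surface_measure] Int_mono cap_mono
        sets_surface_measureI sets.Int cap_sets le_infI1 cap_subset_sphere) auto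
  then show ?thesis unfolding Lam3_eq[OF assms] by (rule borel_measurable_mono)
qed

text \<open>Linearity needs each term to be integrable by itself: the cap intersections are bounded
  by the total mass 2 pi^2, the term with \<open>C\<close> by a crude estimate on the bounded range
  of radii, and the integrator has finite mass there.\<close>

lemma stieltjes_integral_U:
  fixes w :: "nat \<Rightarrow> real ^ 4"
  assumes inj: "inj_on w {1..m}" and W: "contact_configuration (w ` {1..m})"
  shows "stieltjes_integral 0 r4 (U (w ` {1..m})) sec4
    = stieltjes_integral 0 r4 (\<lambda>r. 2 * pi\<^sup>2 - real m * C r) sec4
      + (\<Sum>i\<in>{1..m}. \<Sum>j\<in>{i<..m}. 4 * omega4 (ang (w i) (w j)))
      - (\<Sum>i\<in>{1..m}. \<Sum>j\<in>{i<..m}. \<Sum>k\<in>{j<..m}. 4 * omega3 (ang (w i) (w j)) (ang (w i) (w k)) (ang (w j) (w k)))"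
proof -
  interpret stieltjes 0 r4 sec4 using r4_bounds by (intro stieltjes_sec4) auto
  have n: "norm (w i) = 1" if "i \<in> {1..m}" for i
    using W that by (intro norm_contact_configuration) auto
  define c where "c r = 2 * pi\<^sup>2 - real m * C r" for r
  define l where "l i j r = Lam r (ang (w i) (w j))" for i j r
  define t where "t i j k r = Lam3 r (ang (w i) (w j)) (ang (w i) (w k)) (ang (w j) (w k))" for i j k r
  let ?h = "\<lambda>r. c r + (\<Sum>i\<in>{1..m}. \<Sum>j\<in>{i<..m}. l i j r) - (\<Sum>i\<in>{1..m}. \<Sum>j\<in>{i<..m}. \<Sum>k\<in>{j<..m}. t i j k r)"
  let ?M = "stieltjes_measure 0 r4 sec4"
  let ?I = "\<lambda>f x. indicator {0<..r4} x *\<^sub>R (f x :: real)"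
  have lm: "l i j \<in> borel_measurable borel" if "i \<in> {1..m}" "j \<in> {i<..m}" for i j
    unfolding l_def[abs_def] using that by (intro borel_measurable_Lam n) auto
  have tm: "t i j k \<in> borel_measurable borel" if "i \<in> {1..m}" "j \<in> {i<..m}" "k \<in> {j<..m}" for i j k
    unfolding t_def[abs_def] using that by (intro borel_measurable_Lam3 n) auto
  have hl: "has_bochner_integral ?M (?I (l i j)) (4 * omega4 (ang (w i) (w j)))"
    if "i \<in> {1..m}" "j \<in> {i<..m}" for i j
  proof -
    have "\<bar>l i j r\<bar> \<le> 2 * pi\<^sup>2" for r
      unfolding l_def using that by (subst Lam_eq) (auto simp: n sigma3_le)
    from has_bochner_integral_stieltjes_integral[OF lm[OF that] this]
    show ?thesis by (simp add: omega4_def l_def[abs_def])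
  qed
  have ht: "has_bochner_integral ?M (?I (t i j k)) (4 * omega3 (ang (w i) (w j)) (ang (w i) (w k)) (ang (w j) (w k)))"
    if "i \<in> {1..m}" "j \<in> {i<..m}" "k \<in> {j<..m}" for i j k
  proof -
    have "\<bar>t i j k r\<bar> \<le> 2 * pi\<^sup>2" for r
      unfolding t_def using that by (subst Lam3_eq) (auto simp: n sigma3_le)
    from has_bochner_integral_stieltjes_integral[OF tm[OF that] this]
    show ?thesis by (simp add: omega3_def t_def[abs_def])
  qed
  have cm: "c \<in> borel_measurable borel" unfolding c_def[abs_def] by measurable
  have hc: "has_bochner_integral ?M (?I c) (stieltjes_integral 0 r4 c sec4)"
  proof (rule has_bochner_integral_stieltjes_integral[OF cm])
    fix r assume r: "r \<in> {0<..r4}"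
    have "\<bar>C r\<bar> = pi * \<bar>2 * r - sin (2 * r)\<bar>" by (simp add: C_def abs_mult)
    also have "\<bar>2 * r - sin (2 * r)\<bar> \<le> 2 * r4 + 1"
      using r sin_le_one[of "2 * r"] sin_ge_minus_one[of "2 * r"] unfolding abs_le_iff greaterThanAtMost_iff by linarith
    finally have C: "\<bar>C r\<bar> \<le> pi * (2 * r4 + 1)" by simp
    have "\<bar>c r\<bar> \<le> \<bar>2 * pi\<^sup>2\<bar> + \<bar>real m * C r\<bar>" unfolding c_def by (rule abs_triangle_ineq4)
    also have "\<dots> \<le> 2 * pi\<^sup>2 + real m * (pi * (2 * r4 + 1))"
      using C by (intro add_mono) (simp_all add: abs_mult mult_left_mono)
    finally show "\<bar>c r\<bar> \<le> 2 * pi\<^sup>2 + real m * (pi * (2 * r4 + 1))" .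
  qed
  have hm: "?h \<in> borel_measurable borel"
    using lm tm by (intro borel_measurable_add borel_measurable_diff borel_measurable_sum cm)
  have "has_bochner_integral ?M
    (\<lambda>x. ?I c x + (\<Sum>i\<in>{1..m}. \<Sum>j\<in>{i<..m}. ?I (l i j) x)
      - (\<Sum>i\<in>{1..m}. \<Sum>j\<in>{i<..m}. \<Sum>k\<in>{j<..m}. ?I (t i j k) x))
    (stieltjes_integral 0 r4 c sec4
      + (\<Sum>i\<in>{1..m}. \<Sum>j\<in>{i<..m}. 4 * omega4 (ang (w i) (w j)))
      - (\<Sum>i\<in>{1..m}. \<Sum>j\<in>{i<..m}. \<Sum>k\<in>{j<..m}. 4 * omega3 (ang (w i) (w j)) (ang (w i) (w k)) (ang (w j) (w k))))"
    by (intro has_bochner_integral_diff has_bochner_integral_add has_bochner_integral_sum hc hl ht)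
  then have "has_bochner_integral ?M (?I ?h)
    (stieltjes_integral 0 r4 c sec4
      + (\<Sum>i\<in>{1..m}. \<Sum>j\<in>{i<..m}. 4 * omega4 (ang (w i) (w j)))
      - (\<Sum>i\<in>{1..m}. \<Sum>j\<in>{i<..m}. \<Sum>k\<in>{j<..m}. 4 * omega3 (ang (w i) (w j)) (ang (w i) (w k)) (ang (w j) (w k))))"
    by (simp add: algebra_simps sum_distrib_left)
  then have h: "stieltjes_integral 0 r4 ?h sec4 = stieltjes_integral 0 r4 c sec4
      + (\<Sum>i\<in>{1..m}. \<Sum>j\<in>{i<..m}. 4 * omega4 (ang (w i) (w j)))
      - (\<Sum>i\<in>{1..m}. \<Sum>j\<in>{i<..m}. \<Sum>k\<in>{j<..m}. 4 * omega3 (ang (w i) (w j)) (ang (w i) (w k)) (ang (w j) (w k)))"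
    unfolding stieltjes_integral_eq[of _ _ ?h] set_lebesgue_integral_def
    by (rule has_bochner_integral_integral_eq)
  \<comment> \<open>The integrands are known to agree only for \<open>0 < r\<close> and
    \<open>r < r4\<close>, which suffices because the endpoint \<open>r4\<close> is not an
    atom.\<close>
  have "stieltjes_integral 0 r4 (U (w ` {1..m})) sec4 = stieltjes_integral 0 r4 ?h sec4"
  proof (rule stieltjes_integral_cong_Ioo)
    show "U (w ` {1..m}) \<in> borel_measurable borel"
      using n by (intro borel_measurable_U) auto
    show "U (w ` {1..m}) r = ?h r" if "0 < r" "r < r4" for r
      unfolding c_def l_def t_def using that by (intro U_inclusion_exclusion inj W) auto
  qed (fact hm)
  then show ?thesis unfolding h unfolding c_def .
qed

text \<open>The truncation radius is 1 / cos r4, so the upper limit of the radial integral is the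
  very radius up to which inclusion-exclusion stops at triples.\<close>

lemma arccos_sqrt_8_5: "arccos (1 / sqrt (8 / 5)) = r4"
proof -
  have "1 / sqrt (8 / 5) = cos r4" by (simp add: cos_r4 real_sqrt_divide)
  then show ?thesis using r4_bounds by (simp add: arccos_cos)
qed

theorem proposition7p68:
  shows
    "(\<forall>(m::nat) (w :: nat \<Rightarrow> real ^ 4).
        inj_on w {1..m} \<and> contact_configuration (w ` {1..m}) \<and> bounded (cell (w ` {1..m})) \<longrightarrow>
        (let W = w ` {1..m}; \<gamma> = (\<lambda>i j. ang (w i) (w j)) in
          (\<forall>\<rho>\<ge>1.
             vol (cell W \<inter> cball 0 \<rho>)
               = 1 / 4 * (2 * pi\<^sup>2 + stieltjes_integral 0 (arccos (1 / \<rho>)) (U W) sec4) \<and>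
             1 / 4 * (2 * pi\<^sup>2 + stieltjes_integral 0 (arccos (1 / \<rho>)) (U W) sec4)
               \<le> vol (cell W)) \<and>
          (\<forall>r. 0 \<le> r \<and> r < r4 \<longrightarrow>
             U W r = 2 * pi\<^sup>2 - real m * C r
               + (\<Sum>i\<in>{1..m}. \<Sum>j\<in>{i<..m}. Lam r (\<gamma> i j))
               - (\<Sum>i\<in>{1..m}. \<Sum>j\<in>{i<..m}. \<Sum>k\<in>{j<..m}. Lam3 r (\<gamma> i j) (\<gamma> i k) (\<gamma> j k))) \<and>
          (\<forall>r. 0 \<le> r \<and> r < r_star \<longrightarrow>
             U W r = 2 * pi\<^sup>2 - real m * C r
               + (\<Sum>i\<in>{1..m}. \<Sum>j\<in>{i<..m}. Lam r (\<gamma> i j)))))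
     \<and> 7.647558 \<le> A4 \<and> A4 < 7.647559
     \<and> (\<forall>w :: nat \<Rightarrow> real ^ 4.
        inj_on w {1..23} \<and> contact_configuration (w ` {1..23}) \<and> bounded (cell (w ` {1..23})) \<longrightarrow>
        (let W = w ` {1..23}; \<gamma> = (\<lambda>i j. ang (w i) (w j)) in
          vol (cell W) \<ge> vol (cell W \<inter> cball 0 (sqrt (8 / 5))) \<and>
          vol (cell W \<inter> cball 0 (sqrt (8 / 5)))
            = A4 + (\<Sum>i\<in>{1..23}. \<Sum>j\<in>{i<..23}. omega4 (\<gamma> i j))
                 - (\<Sum>i\<in>{1..23}. \<Sum>j\<in>{i<..23}. \<Sum>k\<in>{j<..23}. omega3 (\<gamma> i j) (\<gamma> i k) (\<gamma> j k))))"
proof -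
  have vol: "vol (cell W \<inter> cball 0 \<rho>)
      = 1 / 4 * (2 * pi\<^sup>2 + stieltjes_integral 0 (arccos (1 / \<rho>)) (U W) sec4)"
    if "contact_configuration W" "1 \<le> \<rho>" for W \<rho>
    using that by (intro vol_cell_cball) (auto simp: contact_configuration_def)
  have le: "vol (cell W \<inter> cball 0 \<rho>) \<le> vol (cell W)" if "bounded (cell W)" for W \<rho>
  proof (rule measure_mono_fmeasurable)
    \<comment> \<open>Boundedness enters here: \<open>measure\<close> gives 0 to a set of infinite
      volume, so monotonicity requires the larger set to have finite volume.\<close>
    show "cell W \<in> lmeasurable"
      using that closed_cell by (intro lmeasurable_compact) (simp add: compact_eq_bounded_closed)
    show "cell W \<inter> cball 0 \<rho> \<in> sets lebesgue"
      by (simp add: closed_cell closed_Int lebesgue_closedin)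
  qed simp
  have U0: "U (w ` {1..m}) r = 2 * pi\<^sup>2 - real m * C r + (\<Sum>i\<in>{1..m}. \<Sum>j\<in>{i<..m}. Lam r (ang (w i) (w j)))"
    if "inj_on w {1..m}" "contact_configuration (w ` {1..m})" "0 \<le> r" "r < r_star" for w m r
  proof -
    have "(\<Sum>i\<in>{1..m}. \<Sum>j\<in>{i<..m}. \<Sum>k\<in>{j<..m}. Lam3 r (ang (w i) (w j)) (ang (w i) (w k)) (ang (w j) (w k))) = 0"
      by (intro sum.neutral ballI Lam3_eq_0[OF that]) auto
    then show ?thesis
      using U_inclusion_exclusion[OF that(1-3)] that(4) r_star_less_r4 by simp
  qed
  have main: "vol (cell (w ` {1..23}) \<inter> cball 0 (sqrt (8 / 5)))
      = A4 + (\<Sum>i\<in>{1..23}. \<Sum>j\<in>{i<..23}. omega4 (ang (w i) (w j)))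
        - (\<Sum>i\<in>{1..23}. \<Sum>j\<in>{i<..23}. \<Sum>k\<in>{j<..23}.
            omega3 (ang (w i) (w j)) (ang (w i) (w k)) (ang (w j) (w k)))"
    if "inj_on w {1..23}" "contact_configuration (w ` {1..23})" for w :: "nat \<Rightarrow> real ^ 4"
    using vol[OF that(2), of "sqrt (8 / 5)"] stieltjes_integral_U[OF that]
    by (simp add: arccos_sqrt_8_5 A4_def sum_distrib_left[symmetric] algebra_simps)
  show ?thesis
    unfolding Let_def
    by (intro conjI allI impI A4_bounds; elim conjE)
      (simp_all only: main[symmetric] le vol[symmetric] U0 U_inclusion_exclusion)
qed

end
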